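(* Let $\mathcal{G}\in\{\mathcal{O}(d),\mathcal{SO}(d)\}$, let $G^\star\in\mathcal{G}^n$, let $\Delta\in\mathbb{R}^{nd\times nd}$ be symmetric, and let $C=G^\star G^{\star\top}+\Delta$. Let $\widehat{G}\in\mathcal{O}(d)^n$ be a global maximizer of $\bar f(G)=\operatorname{tr}(G^\top CG)$ over $\mathcal{O}(d)^n$. Suppose that $\|\Delta\|\le\frac{n^{3/4}}{80d^{1/2}}$ and $\|\Delta G^\star\|_\infty\le\frac{n}{400d}$. Let $\{G^k\}_{k\ge0}$ be generated by the Riemannian gradient method $$G^{k+1}=\operatorname{Exp}_{G^k}\big(t_k\operatorname{grad}\bar f(G^k)\big),\qquad k\ge0,$$ with spectral initialization $G^0=\Pi_{\mathcal{G}^n}(\Phi)$ and step sizes satisfying $0<\underline{t}\le t_k\le\frac{1}{4nd}$ for all $k\ge0$ and some $\underline t$. Then the sequence $\{f([G^k])\}_{k\ge0}$ converges Q-linearly to $f([\widehat{G}])$, and the sequence $\{G^k\}_{k\ge0}$ converges R-linearly to some $G^{*}\in[\widehat{G}]$. That is, there are $a>0$ and $\lambda\in(0,1)$ with, for all $k\ge 0$, $f([\widehat{G}])-f([G^k])\le(f([\widehat{G}])-f([G^0]))\lambda^k$ and $\|G^k-G^{*}\|_F\le a\,(f([\widehat{G}])-f([G^0]))^{1/2}\lambda^{k/2}$.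
   Context: Block notation: $X\in\mathbb{R}^{nd\times d}$ is written $X=[X_1;\dots;X_n]$ with $d\times d$ blocks $X_i$ stacked in a column; for an $nd\times nd$ matrix $C$, $C_{i,:}$ is its $i$-th $d\times nd$ block row. $\mathcal{G}^n$ is the set of $X$ with every $X_i\in\mathcal{G}$. $\|\cdot\|$ is the operator norm, $\|\cdot\|_F$ the Frobenius norm, and $\|X\|_\infty:=\max_i\|X_i\|_F$ for $X\in\mathbb{R}^{nd\times d}$. $[X]=\{XQ:Q\in\mathcal{O}(d)\}$ and $f([G]):=\bar f(G)$ (well defined on classes). $\Phi\in\mathbb{R}^{nd\times d}$ is a matrix of top $d$ eigenvectors of $C$ (columns are mutually orthogonal eigenvectors for the $d$ largest eigenvalues) with $\Phi^\top\Phi=nI_d$. $\Pi_{\mathcal{G}^n}(\Phi)=[\Pi_{\mathcal{G}}(\Phi_1);\dots;\Pi_{\mathcal{G}}(\Phi_n)]$, where $\Pi_{\mathcal{G}}(Z)$ is a Frobenius-nearest point of $\mathcal{G}$ to $Z$. $\mathcal{O}(d)^n$ carries the Riemannian metric induced from $\langle X,Y\rangle=\operatorname{tr}(X^\top Y)$. The Riemannian gradient has blocks $(\operatorname{grad}\bar f(G))_i=C_{i,:}G-G_i(C_{i,:}G)^\top G_i$, and for $\xi=[G_1E_1;\dots;G_nE_n]$ with $E_i$ skew-symmetric, $\operatorname{Exp}_G(\xi)=[G_1\exp(E_1);\dots;G_n\exp(E_n)]$ with $\exp$ the matrix exponential.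
   Formalization: For $\mathcal{G}=\mathcal{SO}(d)$ it is additionally assumed that some block $\Phi_i$ has positive determinant (correct orientation of $\Phi$); without this the claim can fail for $d\ge2$, since $\Phi$ is only determined up to right multiplication by $\mathcal{O}(d)$. *)

theory Defs
  imports "HOL-Analysis.Analysis"
begin

text \<open>
  Row \<open>(i, a)\<close> of a block column in \<open>\<real>\<^sup>n\<^sup>d\<^sup>\<times>\<^sup>d\<close> is row \<open>a\<close> of its block \<open>i\<close>, with \<open>n = CARD('n)\<close> and
  \<open>d = CARD('d)\<close>; matrices in \<open>\<real>\<^sup>n\<^sup>d\<^sup>\<times>\<^sup>n\<^sup>d\<close> are indexed in the same way.  On all these types the
  library's \<open>norm\<close> is the Frobenius norm and \<open>X \<bullet> Y\<close> is the trace inner product.  Pointwise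
  multiplication \<open>*\<close> on \<open>vec\<close>, and hence \<open>^\<close>, is not the matrix product.
\<close>

type_synonym ('n, 'd) bcol = "real ^ 'd ^ ('n \<times> 'd)"
type_synonym ('n, 'd) bmat = "real ^ ('n \<times> 'd) ^ ('n \<times> 'd)"

definition block :: "('n::finite, 'd::finite) bcol \<Rightarrow> 'n \<Rightarrow> real ^ 'd ^ 'd" where
  "block X i = (\<chi> a b. X $ (i, a) $ b)"

definition stack :: "('n::finite \<Rightarrow> real ^ 'd ^ 'd) \<Rightarrow> ('n, 'd::finite) bcol" where
  "stack B = (\<chi> r. B (fst r) $ snd r)"

lemma block_stack [simp]: "block (stack B) i = B i"
  by (simp add: block_def stack_def vec_eq_iff)

lemma stack_block [simp]: "stack (block X) = X"
  by (simp add: block_def stack_def vec_eq_iff)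

definition blocks_in :: "(real ^ 'd ^ 'd) set \<Rightarrow> ('n::finite, 'd::finite) bcol set" where
  "blocks_in \<G> = {X. \<forall>i. block X i \<in> \<G>}"

definition O_group :: "(real ^ 'd ^ 'd) set" where
  "O_group = {Q. orthogonal_matrix Q}"

definition SO_group :: "(real ^ 'd ^ 'd) set" where
  "SO_group = {Q. rotation_matrix Q}"

definition block_sup_norm :: "('n::finite, 'd::finite) bcol \<Rightarrow> real" where
  "block_sup_norm X = (MAX i. norm (block X i))"

definition op_norm :: "real ^ 'a::finite ^ 'b::finite \<Rightarrow> real" where
  "op_norm A = onorm (\<lambda>x. A *v x)"

definition objective :: "('n::finite, 'd::finite) bmat \<Rightarrow> ('n, 'd) bcol \<Rightarrow> real" where
  "objective C G = trace (transpose G ** C ** G)"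

definition orbit :: "('n::finite, 'd::finite) bcol \<Rightarrow> ('n, 'd) bcol set" where
  "orbit X = {X ** Q | Q. Q \<in> O_group}"

text \<open>
  The objective on classes is the common value of \<open>objective C\<close> on the class; the lemma below is its
  well-definedness.
\<close>

definition quotient_objective :: "('n::finite, 'd::finite) bmat \<Rightarrow> ('n, 'd) bcol set \<Rightarrow> real" where
  "quotient_objective C S = the_elem (objective C ` S)"

lemma objective_orthogonal_invariant:
  assumes "Q \<in> O_group"
  shows "objective C (G ** Q) = objective C G"
proof -
  have Q: "Q ** transpose Q = mat 1"
    using assms by (simp add: O_group_def orthogonal_matrix_def)
  have "objective C (G ** Q) = trace (transpose Q ** (transpose G ** C ** G ** Q))"
    by (simp add: objective_def matrix_transpose_mul matrix_mul_assoc)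
  also have "\<dots> = trace (transpose G ** C ** G ** Q ** transpose Q)"
    by (rule trace_mul_sym)
  also have "\<dots> = objective C G"
    by (simp add: objective_def matrix_mul_assoc [symmetric] Q)
  finally show ?thesis .
qed

lemma quotient_objective_orbit: "quotient_objective C (orbit G) = objective C G"
proof -
  have "(mat 1 :: real ^ 'b ^ 'b) \<in> O_group"
    by (simp add: O_group_def orthogonal_matrix_def transpose_mat)
  then have "objective C ` orbit G = {objective C G}"
    by (force simp: orbit_def objective_orthogonal_invariant)
  then show ?thesis
    by (simp add: quotient_objective_def)
qed

text \<open>
  \<open>\<mu> 0 \<ge> \<mu> 1 \<ge> \<dots>\<close> lists the eigenvalues of \<open>A\<close>, each one as often as the dimension of its eigenspace.
  For symmetric \<open>A\<close> this lists all of them with multiplicity.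
\<close>

definition ordered_eigenvalues :: "real ^ 'a ^ 'a \<Rightarrow> (nat \<Rightarrow> real) \<Rightarrow> bool" where
  "ordered_eigenvalues A \<mu> \<longleftrightarrow>
     antimono_on {..<CARD('a::finite)} \<mu> \<and>
     (\<forall>x. card {i. i < CARD('a) \<and> \<mu> i = x} = dim {v. A *v v = x *\<^sub>R v})"

text \<open>The order in which the columns use the top eigenvalues is left open.\<close>

definition top_eigenvectors :: "real ^ 'a::finite ^ 'a \<Rightarrow> real ^ 'd::finite ^ 'a \<Rightarrow> bool" where
  "top_eigenvectors A \<Phi> \<longleftrightarrow>
     (\<exists>\<mu> \<sigma>. ordered_eigenvalues A \<mu> \<and> bij_betw \<sigma> (UNIV :: 'd set) {..<CARD('d)} \<and>
        (\<forall>j. column j \<Phi> \<noteq> 0 \<and> A *v column j \<Phi> = \<mu> (\<sigma> j) *\<^sub>R column j \<Phi>)) \<and>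
     (\<forall>j k. j \<noteq> k \<longrightarrow> orthogonal (column j \<Phi>) (column k \<Phi>))"

text \<open>
  A nearest point of \<open>\<G>\<close> need not be unique, so the blockwise projection is a relation: \<open>P\<close> is
  obtained from \<open>Z\<close> by some choice of nearest points.
\<close>

definition is_block_projection ::
  "(real ^ 'd ^ 'd) set \<Rightarrow> ('n::finite, 'd::finite) bcol \<Rightarrow> ('n, 'd) bcol \<Rightarrow> bool" where
  "is_block_projection \<G> Z P \<longleftrightarrow>
     (\<forall>i. is_arg_min (\<lambda>Q. norm (block Z i - Q)) (\<lambda>Q. Q \<in> \<G>) (block P i))"

definition matrix_exp :: "real ^ 'd ^ 'd \<Rightarrow> real ^ 'd::finite ^ 'd" where
  "matrix_exp A = (\<Sum>k. (1 / fact k) *\<^sub>R (((**) A) ^^ k) (mat 1))"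

definition riemannian_grad ::
  "('n::finite, 'd::finite) bmat \<Rightarrow> ('n, 'd) bcol \<Rightarrow> ('n, 'd) bcol" where
  "riemannian_grad C G =
     stack (\<lambda>i. block (C ** G) i - block G i ** transpose (block (C ** G) i) ** block G i)"

text \<open>
  A tangent vector at \<open>G\<close> has blocks \<open>\<xi>\<^sub>i = G\<^sub>i E\<^sub>i\<close> with \<open>E\<^sub>i\<close> skew-symmetric, so that
  \<open>E\<^sub>i = G\<^sub>i\<^sup>T \<xi>\<^sub>i\<close>.
\<close>

definition riemannian_exp ::
  "('n::finite, 'd::finite) bcol \<Rightarrow> ('n, 'd) bcol \<Rightarrow> ('n, 'd) bcol" where
  "riemannian_exp G \<xi> =
     stack (\<lambda>i. block G i ** matrix_exp (transpose (block G i) ** block \<xi> i))"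

lemma riemannian_exp_tangent:
  assumes "G \<in> blocks_in O_group"
  shows "riemannian_exp G (stack (\<lambda>i. block G i ** E i)) =
           stack (\<lambda>i. block G i ** matrix_exp (E i))"
proof -
  have "transpose (block G i) ** block G i = mat 1" for i
    using assms by (simp add: blocks_in_def O_group_def orthogonal_matrix_def)
  then show ?thesis
    by (simp add: riemannian_exp_def matrix_mul_assoc)
qed

lemma riemannian_grad_tangent:
  fixes C :: "('n::finite, 'd::finite) bmat" and G :: "('n, 'd) bcol"
  assumes "G \<in> blocks_in O_group"
  defines "E \<equiv> \<lambda>i. transpose (block G i) ** block (C ** G) i
                      - transpose (block (C ** G) i) ** block G i"
  shows "riemannian_grad C G = stack (\<lambda>i. block G i ** E i)"
    and "transpose (E i) = - E i"
proof -
  have sub: "A ** (B - D) = A ** B - A ** D" for A B D :: "real ^ 'd ^ 'd"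
    by (simp add: matrix_matrix_mult_def vec_eq_iff right_diff_distrib sum_subtractf)
  have "block G i ** transpose (block G i) = mat 1" for i
    using assms(1) by (simp add: blocks_in_def O_group_def orthogonal_matrix_def)
  then show "riemannian_grad C G = stack (\<lambda>i. block G i ** E i)"
    by (simp add: riemannian_grad_def E_def sub matrix_mul_assoc)
  have diff: "transpose (A - B) = transpose A - transpose B" for A B :: "real ^ 'd ^ 'd"
    by (simp add: transpose_def vec_eq_iff)
  show "transpose (E i) = - E i"
    by (simp add: E_def diff matrix_transpose_mul)
qed

definition converges_Q_linearly :: "(nat \<Rightarrow> 'a::metric_space) \<Rightarrow> 'a \<Rightarrow> bool" where
  "converges_Q_linearly x L \<longleftrightarrow>
     (\<exists>\<rho>. 0 < \<rho> \<and> \<rho> < 1 \<and> (\<forall>k. dist (x (Suc k)) L \<le> \<rho> * dist (x k) L))"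

definition converges_R_linearly :: "(nat \<Rightarrow> 'a::metric_space) \<Rightarrow> 'a \<Rightarrow> bool" where
  "converges_R_linearly x L \<longleftrightarrow>
     (\<exists>a \<rho>. 0 < a \<and> 0 < \<rho> \<and> \<rho> < 1 \<and> (\<forall>k. dist (x k) L \<le> a * \<rho> ^ k))"

end

theory Submission
  imports Defs
begin

text \<open>
  For a block column \<open>X\<close> with orthogonal blocks, closeness to the orbit of \<open>Gs\<close> is measured by
  \<open>perp X = X - Gs M\<close> with \<open>M = Gs\<^sup>T X / n\<close>, both in Frobenius norm and blockwise.  For the spectral
  initialization the Frobenius norm is of order \<open>n\<^bsup>1/4\<^esup>\<close> and the blockwise norm is a small constant: the
  eigenvector equation gains a factor \<open>op_norm \<Delta> / n\<close> when read block by block.  Monotonicity of the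
  objective keeps the Frobenius bound along the iteration, and each gradient step contracts the
  blocks of \<open>perp X\<close> up to an error that the Frobenius bound controls.

  Near the orbit the symmetric parts of \<open>X\<^sub>i\<^sup>T (C X)\<^sub>i\<close> serve as approximate Lagrange multipliers.  The
  resulting duality argument compares \<open>X\<close> with an arbitrary \<open>Y \<in> O(d)\<^sup>n\<close> and bounds \<open>f Y - f X\<close> by
  the squared gradient at \<open>X\<close>, so nothing needs to be known in advance about the maximizer.  With
  sufficient ascent the optimality gap shrinks geometrically, hence so do the steps, and the same
  inequality identifies the limit as a rotation of the maximizer.
\<close>

subsection \<open>Matrices with the Frobenius inner product\<close>

text \<open>The exponent 3/4 makes two scales fit together. Put \<open>q = n powr (1/4)\<close>. A
  deviation of Frobenius norm \<open>c * q\<close> contributes at most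
  \<open>op_norm \<Delta> * c * q\<close>, hence at most \<open>c * n / 80\<close>, to any single
  block of \<open>\<Delta> ** X\<close>: bounding a block by the whole column is crude, but the
  result is still small against the signal \<open>n\<close>. Conversely, leaving the orbit costs the
  objective \<open>n * (norm (perp X))\<^sup>2\<close>, while the noise can return only order
  \<open>q ^ 5 * norm (perp X)\<close>. The two balance at order \<open>q\<close>, so ascent alone
  reproduces the Frobenius bound. The obstacle is that ascent and duality also need every block to
  be close, and objective values do not detect a few bad blocks. Blockwise closeness must therefore
  be propagated through the step itself, where the largest error is the motion of the reference
  \<open>Gs M\<close>. The constants loosen once per stage: \<open>q / 79\<close> for the
  eigenvectors, \<open>q / 38\<close> after projection, \<open>q / 18\<close> for all
  iterates.\<close>

lemma sq_norm_rows: "(norm A)\<^sup>2 = (\<Sum>i\<in>UNIV. (norm (A $ i))\<^sup>2)"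
  for A :: "real ^ 'c ^ 'b::finite"
  by (simp add: norm_vec_def L2_set_def sum_nonneg)

lemma matmul_row: "(A ** B) $ i = (\<Sum>k\<in>UNIV. A $ i $ k *\<^sub>R B $ k)"
  for A :: "real ^ 'a::finite ^ 'b" and B :: "real ^ 'c ^ 'a"
  by (simp add: matrix_matrix_mult_def vec_eq_iff)

lemma norm_matmul_le: "norm (A ** B) \<le> norm A * norm B"
  for A :: "real ^ 'a::finite ^ 'b::finite" and B :: "real ^ 'c::finite ^ 'a"
proof -
  have row: "norm ((A ** B) $ i) \<le> norm (A $ i) * norm B" for i
  proof -
    have "norm ((A ** B) $ i) \<le> (\<Sum>k\<in>UNIV. \<bar>A $ i $ k\<bar> * \<bar>norm (B $ k)\<bar>)"
      unfolding matmul_row by (rule order_trans[OF norm_sum]) simp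
    also have "\<dots> \<le> L2_set (\<lambda>k. A $ i $ k) UNIV * L2_set (\<lambda>k. norm (B $ k)) UNIV"
      by (rule L2_set_mult_ineq)
    also have "\<dots> = norm (A $ i) * norm B"
      by (simp add: norm_vec_def L2_set_def)
    finally show ?thesis .
  qed
  have "(norm (A ** B))\<^sup>2 \<le> (\<Sum>i\<in>UNIV. (norm (A $ i) * norm B)\<^sup>2)"
    unfolding sq_norm_rows[of "A ** B"] by (intro sum_mono power_mono row) auto
  also have "\<dots> = (norm A * norm B)\<^sup>2"
    by (simp add: sq_norm_rows[of A] power_mult_distrib sum_distrib_right)
  finally show ?thesis
    by (rule power2_le_imp_le) simp
qed

lemma bounded_bilinear_matmul:
  "bounded_bilinear ((**) :: real ^ 'a::finite ^ 'b::finite \<Rightarrow> real ^ 'c::finite ^ 'a \<Rightarrow> real ^ 'c ^ 'b)"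
proof
  show "(A + A') ** B = A ** B + A' ** B" for A A' :: "real ^ 'a ^ 'b" and B :: "real ^ 'c ^ 'a"
    by (simp add: matrix_matrix_mult_def vec_eq_iff distrib_right sum.distrib)
  show "A ** (B + B') = A ** B + A ** B'" for A :: "real ^ 'a ^ 'b" and B B' :: "real ^ 'c ^ 'a"
    by (rule matrix_add_ldistrib)
  show "(r *\<^sub>R A) ** B = r *\<^sub>R (A ** B)" for r and A :: "real ^ 'a ^ 'b" and B :: "real ^ 'c ^ 'a"
    by (simp add: matrix_matrix_mult_def vec_eq_iff sum_distrib_left mult.assoc)
  show "A ** (r *\<^sub>R B) = r *\<^sub>R (A ** B)" for r and A :: "real ^ 'a ^ 'b" and B :: "real ^ 'c ^ 'a"
    by (simp add: matrix_matrix_mult_def vec_eq_iff sum_distrib_left ac_simps)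
  show "\<exists>K. \<forall>A B. norm ((A :: real ^ 'a ^ 'b) ** (B :: real ^ 'c ^ 'a)) \<le> norm A * norm B * K"
    by (rule exI[of _ 1]) (simp add: norm_matmul_le)
qed

interpretation matmul: bounded_bilinear
  "(**) :: real ^ 'a::finite ^ 'b::finite \<Rightarrow> real ^ 'c::finite ^ 'a \<Rightarrow> real ^ 'c ^ 'b"
  by (rule bounded_bilinear_matmul)

lemma bounded_linear_transpose:
  "bounded_linear (transpose :: real ^ 'a::finite ^ 'b::finite \<Rightarrow> real ^ 'b ^ 'a)"
  unfolding linear_conv_bounded_linear[symmetric]
  by (rule linearI) (simp_all add: transpose_def vec_eq_iff)

lemmas transpose_linear =
  linear_add [OF bounded_linear.linear [OF bounded_linear_transpose]] linear_diff [OF bounded_linear.linear [OF bounded_linear_transpose]]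
  linear_neg [OF bounded_linear.linear [OF bounded_linear_transpose]] linear_sum [OF bounded_linear.linear [OF bounded_linear_transpose]]
  linear_scale [OF bounded_linear.linear [OF bounded_linear_transpose]] linear_0 [OF bounded_linear.linear [OF bounded_linear_transpose]]

lemma inner_matrix: "A \<bullet> B = (\<Sum>i\<in>UNIV. \<Sum>j\<in>UNIV. A $ i $ j * B $ i $ j)"
  for A :: "real ^ 'a ^ 'b"
  by (simp add: inner_vec_def)

lemma inner_transpose [simp]: "transpose A \<bullet> transpose B = A \<bullet> B"
  for A :: "real ^ 'a::finite ^ 'b::finite"
  unfolding inner_matrix by (subst sum.swap) (simp add: transpose_def)

lemma norm_transpose [simp]: "norm (transpose A) = norm A"
  for A :: "real ^ 'a::finite ^ 'b::finite"
  by (simp add: norm_eq_sqrt_inner)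

lemma inner_matmul_left: "(A ** B) \<bullet> D = B \<bullet> (transpose A ** D)"
  for A :: "real ^ 'a::finite ^ 'b::finite" and B :: "real ^ 'c::finite ^ 'a"
proof -
  have "(A ** B) \<bullet> D = (\<Sum>i\<in>UNIV. \<Sum>j\<in>UNIV. \<Sum>k\<in>UNIV. A $ i $ k * B $ k $ j * D $ i $ j)"
    by (simp add: inner_matrix matrix_matrix_mult_def sum_distrib_right)
  also have "\<dots> = (\<Sum>i\<in>UNIV. \<Sum>k\<in>UNIV. \<Sum>j\<in>UNIV. A $ i $ k * B $ k $ j * D $ i $ j)"
    by (intro sum.cong refl sum.swap)
  also have "\<dots> = (\<Sum>k\<in>UNIV. \<Sum>i\<in>UNIV. \<Sum>j\<in>UNIV. A $ i $ k * B $ k $ j * D $ i $ j)"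
    by (rule sum.swap)
  also have "\<dots> = (\<Sum>k\<in>UNIV. \<Sum>j\<in>UNIV. \<Sum>i\<in>UNIV. A $ i $ k * B $ k $ j * D $ i $ j)"
    by (intro sum.cong refl sum.swap)
  also have "\<dots> = B \<bullet> (transpose A ** D)"
    by (simp add: inner_matrix matrix_matrix_mult_def transpose_def sum_distrib_left ac_simps)
  finally show ?thesis .
qed

lemma inner_matmul_right: "(A ** B) \<bullet> D = A \<bullet> (D ** transpose B)"
  for A :: "real ^ 'a::finite ^ 'b::finite" and B :: "real ^ 'c::finite ^ 'a"
proof -
  have "(A ** B) \<bullet> D = (transpose B ** transpose A) \<bullet> transpose D"
    by (simp add: matrix_transpose_mul[symmetric])
  also have "\<dots> = transpose A \<bullet> transpose (D ** transpose B)"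
    by (simp only: inner_matmul_left matrix_transpose_mul)
  finally show ?thesis by simp
qed

lemma trace_transpose_matmul: "trace (transpose A ** B) = A \<bullet> B"
  for A :: "real ^ 'a::finite ^ 'b::finite"
  unfolding trace_def matrix_matrix_mult_def transpose_def inner_matrix
  by (subst sum.swap) simp

lemma inner_symmetric_skew: "S \<bullet> K = 0" if "transpose S = S" "transpose K = - K"
  for S K :: "real ^ 'a::finite ^ 'a"
  using inner_transpose[of S K] that by simp

lemma inner_skew_quadratic: "N \<bullet> (K ** N) = 0" if "transpose K = - K"
  for N :: "real ^ 'c::finite ^ 'a::finite"
  using inner_matmul_left[of K N N] that by (simp add: inner_commute matmul.minus_left)

lemma norm_orthogonal_left: "norm (A ** B) = norm B" if "transpose A ** A = mat 1"
  for A :: "real ^ 'a::finite ^ 'b::finite" and B :: "real ^ 'c::finite ^ 'a"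
  by (simp add: norm_eq_sqrt_inner inner_matmul_left matrix_mul_assoc that)

lemma sq_norm_columns: "(norm A)\<^sup>2 = (\<Sum>j\<in>UNIV. (norm (column j A))\<^sup>2)"
  for A :: "real ^ 'a::finite ^ 'b::finite"
  using sq_norm_rows[of "transpose A"] unfolding norm_transpose
  by (simp add: transpose_def column_def)

lemma column_matmul: "column j (A ** B) = A *v column j B"
  for A :: "real ^ 'a::finite ^ 'b::finite"
  by (simp add: column_def matrix_matrix_mult_def matrix_vector_mult_def vec_eq_iff)

lemma op_norm_nonneg: "0 \<le> op_norm A"
  unfolding op_norm_def by (rule onorm_pos_le) (rule matrix_vector_mul_bounded_linear)

lemma norm_matvec_le_op: "norm (A *v x) \<le> op_norm A * norm x"
  unfolding op_norm_def by (rule onorm) (rule matrix_vector_mul_bounded_linear)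

lemma norm_matmul_le_op: "norm (A ** B) \<le> op_norm A * norm B"
  for A :: "real ^ 'a::finite ^ 'b::finite" and B :: "real ^ 'c::finite ^ 'a"
proof -
  have "(norm (A ** B))\<^sup>2 \<le> (\<Sum>j\<in>UNIV. (op_norm A * norm (column j B))\<^sup>2)"
    unfolding sq_norm_columns[of "A ** B"] column_matmul
    by (intro sum_mono power_mono norm_matvec_le_op) auto
  also have "\<dots> = (op_norm A * norm B)\<^sup>2"
    by (simp add: sq_norm_columns[of B] power_mult_distrib sum_distrib_left)
  finally show ?thesis
    by (rule power2_le_imp_le) (simp add: op_norm_nonneg)
qed

section \<open>Block columns\<close>

lemma bounded_linear_block: "bounded_linear (\<lambda>X :: ('n::finite, 'd::finite) bcol. block X i)"
  unfolding linear_conv_bounded_linear[symmetric]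
  by (rule linearI) (simp_all add: block_def vec_eq_iff)

lemmas block_linear =
  linear_add [OF bounded_linear.linear [OF bounded_linear_block]] linear_diff [OF bounded_linear.linear [OF bounded_linear_block]]
  linear_neg [OF bounded_linear.linear [OF bounded_linear_block]] linear_sum [OF bounded_linear.linear [OF bounded_linear_block]]
  linear_scale [OF bounded_linear.linear [OF bounded_linear_block]] linear_0 [OF bounded_linear.linear [OF bounded_linear_block]]

lemma block_eqI: "X = Y" if "\<And>i. block X i = block Y i"
  using that by (metis stack_block ext)

lemma block_matmul: "block (X ** Q) i = block X i ** Q"
  by (simp add: block_def matrix_matrix_mult_def vec_eq_iff)

lemma sum_UNIV_prod: "sum f UNIV = (\<Sum>i\<in>UNIV. \<Sum>a\<in>UNIV. f (i, a))"
  by (simp add: sum.cartesian_product)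

lemma inner_block: "X \<bullet> Y = (\<Sum>i\<in>UNIV. block X i \<bullet> block Y i)"
  for X :: "('n::finite, 'd::finite) bcol"
  by (simp add: inner_matrix block_def sum_UNIV_prod)

lemma sq_norm_block: "(norm X)\<^sup>2 = (\<Sum>i\<in>UNIV. (norm (block X i))\<^sup>2)"
  by (simp add: power2_norm_eq_inner inner_block)

lemma norm_block_le: "norm (block X i) \<le> norm X"
proof (rule power2_le_imp_le)
  show "(norm (block X i))\<^sup>2 \<le> (norm X)\<^sup>2"
    unfolding sq_norm_block[of X] by (rule member_le_sum) auto
qed simp

lemma block_transpose_matmul:
  "transpose X ** Y = (\<Sum>i\<in>UNIV. transpose (block X i) ** block Y i)"
  for X Y :: "('n::finite, 'd::finite) bcol"
  by (simp add: vec_eq_iff matrix_matrix_mult_def block_def transpose_def sum_UNIV_prod)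

lemma norm_block_le_sup: "norm (block X i) \<le> block_sup_norm X"
  unfolding block_sup_norm_def by (rule Max_ge) auto

lemma objective_inner: "objective C G = G \<bullet> (C ** G)"
  by (simp add: objective_def matrix_mul_assoc[symmetric] trace_transpose_matmul)

subsection \<open>The matrix exponential\<close>

abbreviation matpow :: "real ^ 'd ^ 'd \<Rightarrow> nat \<Rightarrow> real ^ 'd::finite ^ 'd" where
  "matpow A k \<equiv> ((**) A ^^ k) (mat 1)"

text \<open>Positive exponents only: the identity has Frobenius norm \<open>sqrt d\<close>, so
  exponent 0 breaks the bound as soon as d > 1.\<close>

lemma norm_matpow_Suc_le: "norm (matpow A (Suc k)) \<le> norm A ^ Suc k"
proof (induction k)
  case (Suc k)
  have "norm (matpow A (Suc (Suc k))) \<le> norm A * norm (matpow A (Suc k))"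
    using norm_matmul_le[of A "matpow A (Suc k)"] by simp
  also have "\<dots> \<le> norm A * norm A ^ Suc k"
    by (intro mult_left_mono Suc.IH) simp
  finally show ?case by simp
qed simp

lemma norm_matpow_le: "norm (matpow A k) \<le> (1 + norm (mat 1 :: real ^ 'd ^ 'd)) * norm A ^ k"
  for A :: "real ^ 'd::finite ^ 'd"
proof (cases k)
  case (Suc m)
  have "norm A ^ k \<le> (1 + norm (mat 1 :: real ^ 'd ^ 'd)) * norm A ^ k"
    by (simp add: algebra_simps)
  then show ?thesis
    using norm_matpow_Suc_le[of m A] Suc by simp
qed simp

lemma summable_matrix_exp: "summable (\<lambda>k. (1 / fact k) *\<^sub>R matpow A k)"
proof (rule summable_comparison_test')
  show "summable (\<lambda>k. (1 + norm (mat 1 :: real ^ 'a ^ 'a)) * (inverse (fact k) * norm A ^ k))"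
    by (intro summable_mult summable_exp)
  show "norm ((1 / fact k) *\<^sub>R matpow A k)
      \<le> (1 + norm (mat 1 :: real ^ 'a ^ 'a)) * (inverse (fact k) * norm A ^ k)" for k
    using norm_matpow_le[of k A] by (simp add: divide_simps)
qed

lemma two_power_le_fact: "2 ^ Suc k \<le> (fact (k + 2) :: real)"
proof (induction k)
  case (Suc k)
  have "(2::real) ^ Suc (Suc k) \<le> 2 * fact (k + 2)"
    using Suc by (simp add: algebra_simps)
  also have "\<dots> \<le> real (k + 3) * fact (k + 2)"
    by (intro mult_right_mono) auto
  also have "\<dots> = fact (Suc k + 2)"
    by (simp add: algebra_simps)
  finally show ?case .
qed simp

text \<open>From the quadratic term on, \<open>fact (k + 2)\<close> is at least
  \<open>2 ^ Suc k\<close>, so the tail is dominated by \<open>(norm A)\<^sup>2\<close> times a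
  geometric series with sum exactly 1.\<close>

lemma norm_matrix_exp_remainder:
  assumes "norm A \<le> 1"
  shows "norm (matrix_exp A - mat 1 - A) \<le> (norm A)\<^sup>2"
proof -
  let ?f = "\<lambda>k. (1 / fact k) *\<^sub>R matpow A k"
  let ?g = "\<lambda>k. (norm A)\<^sup>2 * (1 / 2) ^ Suc k"
  have "matrix_exp A = (\<Sum>k. ?f (k + 2)) + (\<Sum>k<2. ?f k)"
    unfolding matrix_exp_def by (rule suminf_split_initial_segment[OF summable_matrix_exp])
  then have eq: "matrix_exp A - mat 1 - A = (\<Sum>k. ?f (k + 2))"
    by (simp add: numeral_2_eq_2)
  have g: "?g sums ((norm A)\<^sup>2 * 1)"
    by (intro sums_mult power_half_series)
  have le: "norm (?f (k + 2)) \<le> ?g k" for k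
  proof -
    have "norm (?f (k + 2)) \<le> norm A ^ (k + 2) / fact (k + 2)"
      using norm_matpow_Suc_le[of "Suc k" A] by (simp add: divide_right_mono del: fact_Suc)
    also have "\<dots> \<le> (norm A)\<^sup>2 / 2 ^ Suc k"
    proof (rule frac_le)
      show "norm A ^ (k + 2) \<le> (norm A)\<^sup>2"
        by (rule power_decreasing) (use assms in auto)
    qed (use two_power_le_fact[of k] in auto)
    finally show ?thesis by (simp add: field_simps)
  qed
  have "norm (\<Sum>k. ?f (k + 2)) \<le> (\<Sum>k. ?g k)"
    by (rule norm_suminf_le[OF le]) (use g in \<open>simp add: sums_iff\<close>)
  then show ?thesis
    using g by (simp add: eq sums_iff)
qed

lemma matpow_scaleR: "matpow (s *\<^sub>R A) k = s ^ k *\<^sub>R matpow A k"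
  by (induction k) (simp_all add: matmul.scaleR_left matmul.scaleR_right)

lemma matrix_exp_entry:
  shows "summable (\<lambda>k. matpow A k $ i $ j / fact k * s ^ k)"
    and "matrix_exp (s *\<^sub>R A) $ i $ j = (\<Sum>k. matpow A k $ i $ j / fact k * s ^ k)"
proof -
  have "bounded_linear (\<lambda>M :: real ^ 'a ^ 'a. M $ i $ j)"
    using bounded_linear_compose[OF bounded_linear_vec_nth bounded_linear_vec_nth] .
  from bounded_linear.sums[OF this summable_sums[OF summable_matrix_exp[of "s *\<^sub>R A"]]]
  have "(\<lambda>k. matpow A k $ i $ j / fact k * s ^ k) sums (matrix_exp (s *\<^sub>R A) $ i $ j)"
    by (simp add: matpow_scaleR matrix_exp_def mult.commute)
  then show "summable (\<lambda>k. matpow A k $ i $ j / fact k * s ^ k)"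
    and "matrix_exp (s *\<^sub>R A) $ i $ j = (\<Sum>k. matpow A k $ i $ j / fact k * s ^ k)"
    by (simp_all add: sums_iff)
qed

text \<open>The differential equation of \<open>exp (s A)\<close>, taken entrywise so that termwise
  differentiation of real power series applies.\<close>

lemma matrix_exp_entry_deriv:
  "((\<lambda>s. matrix_exp (s *\<^sub>R A) $ i $ j) has_field_derivative
      (\<Sum>l\<in>UNIV. A $ i $ l * matrix_exp (s *\<^sub>R A) $ l $ j)) (at s)"
proof -
  let ?c = "\<lambda>i k. matpow A k $ i $ j / fact k"
  have "diffs (?c i) k * s ^ k = (\<Sum>l\<in>UNIV. A $ i $ l * (?c l k * s ^ k))" for k
  proof -
    have "matpow A (Suc k) $ i $ j = (\<Sum>l\<in>UNIV. A $ i $ l * matpow A k $ l $ j)"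
      by (simp add: matrix_matrix_mult_def)
    moreover have "diffs (?c i) k = matpow A (Suc k) $ i $ j / fact k"
      by (simp add: diffs_def del: of_nat_Suc funpow.simps)
    ultimately show ?thesis
      by (simp add: sum_distrib_right sum_divide_distrib mult.assoc del: funpow.simps)
  qed
  then have "(\<Sum>k. diffs (?c i) k * s ^ k) = (\<Sum>k. \<Sum>l\<in>UNIV. A $ i $ l * (?c l k * s ^ k))"
    by presburger
  also have "\<dots> = (\<Sum>l\<in>UNIV. \<Sum>k. A $ i $ l * (?c l k * s ^ k))"
    by (intro suminf_sum summable_mult matrix_exp_entry(1))
  also have "\<dots> = (\<Sum>l\<in>UNIV. A $ i $ l * matrix_exp (s *\<^sub>R A) $ l $ j)"
    by (simp only: suminf_mult[OF matrix_exp_entry(1)] matrix_exp_entry(2))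
  finally have "(\<Sum>k. diffs (?c i) k * s ^ k)
      = (\<Sum>l\<in>UNIV. A $ i $ l * matrix_exp (s *\<^sub>R A) $ l $ j)" .
  with termdiffs_strong_converges_everywhere[OF matrix_exp_entry(1)[of A i j], of s]
  show ?thesis
    unfolding matrix_exp_entry(2) by (simp only:)
qed

text \<open>Skewness makes the derivative in \<open>s\<close> of every entry of
  \<open>exp (s A)\<^sup>T exp (s A)\<close> vanish, so the Gram matrix keeps its value at
  \<open>s = 0\<close>. This replaces a product law for exponentials.\<close>

lemma orthogonal_matrix_exp:
  fixes A :: "real ^ 'd::finite ^ 'd"
  assumes skew: "transpose A = - A"
  shows "orthogonal_matrix (matrix_exp A)"
proof -
  define g where "g i j s = matrix_exp (s *\<^sub>R A) $ i $ j" for i j s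
  have A: "A $ m $ l = - A $ l $ m" for l m
  proof -
    have "transpose A $ l $ m = - A $ l $ m" using skew by simp
    then show ?thesis by (simp add: transpose_def)
  qed
  have const: "(\<Sum>l\<in>UNIV. g l i s * g l j s) = (\<Sum>l\<in>UNIV. g l i 0 * g l j 0)" for i j s
  proof -
    have "((\<lambda>s. \<Sum>l\<in>UNIV. g l i s * g l j s) has_field_derivative 0) (at s)" for s
    proof -
      have "((\<lambda>s. \<Sum>l\<in>UNIV. g l i s * g l j s) has_field_derivative
          (\<Sum>l\<in>UNIV. (\<Sum>m\<in>UNIV. A $ l $ m * g m i s) * g l j s
            + (\<Sum>m\<in>UNIV. A $ l $ m * g m j s) * g l i s)) (at s)"
        unfolding g_def by (intro DERIV_sum DERIV_mult matrix_exp_entry_deriv)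
      moreover have "(\<Sum>l\<in>UNIV. \<Sum>m\<in>UNIV. A $ l $ m * g m j s * g l i s)
          = - (\<Sum>l\<in>UNIV. \<Sum>m\<in>UNIV. A $ l $ m * g m i s * g l j s)"
      proof -
        have "(\<Sum>l\<in>UNIV. \<Sum>m\<in>UNIV. A $ l $ m * g m j s * g l i s)
            = (\<Sum>m\<in>UNIV. \<Sum>l\<in>UNIV. A $ l $ m * g m j s * g l i s)"
          by (rule sum.swap)
        also have "\<dots> = (\<Sum>m\<in>UNIV. \<Sum>l\<in>UNIV. - (A $ m $ l * g l i s * g m j s))"
          by (intro sum.cong refl, subst A) simp
        finally show ?thesis by (simp add: sum_negf)
      qed
      ultimately show ?thesis
        by (simp add: sum_distrib_right sum.distrib)
    qed
    then show ?thesis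
      using DERIV_isconst_all[of "\<lambda>s. \<Sum>l\<in>UNIV. g l i s * g l j s" s 0] by blast
  qed
  have "matpow (0 :: real ^ 'd ^ 'd) k = (if k = 0 then mat 1 else 0)" for k
    by (cases k) (simp_all add: matmul.zero_left)
  then have "matrix_exp (0 :: real ^ 'd ^ 'd) = mat 1"
    unfolding matrix_exp_def by (subst suminf_finite[of "{0}"]) auto
  then have "g l i 0 = mat 1 $ l $ i" for l i
    by (simp add: g_def)
  with const[of _ 1] have "transpose (matrix_exp A) ** matrix_exp A = mat 1"
    by (simp add: vec_eq_iff matrix_matrix_mult_def transpose_def g_def mat_def
        if_distrib[of "\<lambda>x. x * _"] cong: if_cong)
  then show ?thesis
    by (simp add: orthogonal_matrix)
qed

text \<open>\<open>P\<close> and the identity have equal norm, so the pairing of the identity with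
  the displacement is purely of second order. In the ascent estimate this tames the dominant
  multiple \<open>n\<close> of the identity.\<close>

lemma sq_norm_diff_mat_1:
  fixes P :: "real ^ 'd::finite ^ 'd"
  assumes "orthogonal_matrix P"
  shows "(norm (P - mat 1))\<^sup>2 = - 2 * (mat 1 \<bullet> (P - mat 1))"
proof -
  have "P \<bullet> P = mat 1 \<bullet> (mat 1 :: real ^ 'd ^ 'd)"
    using assms inner_matmul_left[of P "mat 1" P] by (simp add: orthogonal_matrix_def)
  then show ?thesis
    by (simp add: power2_norm_eq_inner inner_diff_left inner_diff_right inner_commute)
qed

subsection \<open>Polar factors and orthogonal frames\<close>

lemma continuous_on_matmul [continuous_intros]:
  fixes f :: "'t::topological_space \<Rightarrow> real ^ 'a::finite ^ 'b::finite"
    and g :: "'t \<Rightarrow> real ^ 'c::finite ^ 'a"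
  assumes "continuous_on S f" "continuous_on S g"
  shows "continuous_on S (\<lambda>x. f x ** g x)"
  by (rule bounded_bilinear.continuous_on[OF bounded_bilinear_matmul assms])

lemma continuous_on_transpose [continuous_intros]:
  fixes f :: "'t::topological_space \<Rightarrow> real ^ 'a::finite ^ 'b::finite"
  assumes "continuous_on S f"
  shows "continuous_on S (\<lambda>x. transpose (f x))"
  by (rule bounded_linear.continuous_on[OF bounded_linear_transpose assms])

lemma compact_O_group: "compact (O_group :: (real ^ 'd::finite ^ 'd) set)"
proof -
  have eq: "(O_group :: (real ^ 'd ^ 'd) set) = (\<lambda>Q. transpose Q ** Q) -` {mat 1}"
    by (auto simp: O_group_def orthogonal_matrix)
  have "closed (O_group :: (real ^ 'd ^ 'd) set)"
    unfolding eq by (intro closed_vimage continuous_intros)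
  moreover have "norm Q = norm (mat 1 :: real ^ 'd ^ 'd)" if "Q \<in> O_group" for Q :: "real ^ 'd ^ 'd"
  proof -
    have "norm (Q ** (mat 1 :: real ^ 'd ^ 'd)) = norm (mat 1 :: real ^ 'd ^ 'd)"
      by (rule norm_orthogonal_left) (use that in \<open>simp add: O_group_def orthogonal_matrix\<close>)
    then show ?thesis by (simp only: matrix_mul_rid)
  qed
  then have "bounded (O_group :: (real ^ 'd ^ 'd) set)"
    unfolding bounded_iff by (intro exI[of _ "norm (mat 1 :: real ^ 'd ^ 'd)"]) simp
  ultimately show ?thesis
    by (simp add: compact_eq_bounded_closed)
qed

text \<open>First-order optimality without derivatives: for nonzero \<open>b\<close>, a small
  \<open>s\<close> of the opposite sign lets the linear term win. It serves variations along the
  orthogonal group and along a Rayleigh quotient.\<close>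

lemma linear_coeff_zero_if_quadratic_nonneg:
  fixes b c r :: real
  assumes r: "0 < r" and nonneg: "\<And>s. \<bar>s\<bar> \<le> r \<Longrightarrow> 0 \<le> 2 * s * b + s\<^sup>2 * c"
  shows "b = 0"
proof (rule ccontr)
  assume "b \<noteq> 0"
  obtain m where m: "0 < m" "m \<le> r" "m \<le> \<bar>b\<bar> / (1 + \<bar>c\<bar>)"
    using r \<open>b \<noteq> 0\<close> field_lbound_gt_zero[of r "\<bar>b\<bar> / (1 + \<bar>c\<bar>)"]
    by (metis abs_ge_zero add_pos_nonneg divide_pos_pos less_imp_le zero_less_abs_iff zero_less_one)
  then have "m * (1 + \<bar>c\<bar>) \<le> \<bar>b\<bar>"
    by (simp add: pos_le_divide_eq add_pos_nonneg)
  then have mc: "m * \<bar>c\<bar> < \<bar>b\<bar>" using m(1) by (simp add: distrib_left)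
  define s where "s = (if b < 0 then m else - m)"
  have "2 * s * b + s\<^sup>2 * c = m * (m * c - 2 * \<bar>b\<bar>)"
    by (simp add: s_def power2_eq_square algebra_simps)
  then have "0 \<le> m * (m * c - 2 * \<bar>b\<bar>)"
    using nonneg[of s] m by (simp add: s_def split: if_splits)
  then have "2 * \<bar>b\<bar> \<le> m * c" using m(1) by (simp add: zero_le_mult_iff)
  also have "m * c \<le> m * \<bar>c\<bar>" using m(1) by simp
  finally show False using mc by simp
qed

text \<open>The rank-one matrix \<open>v v\<^sup>T\<close>; for unit \<open>v\<close>,
  \<open>mat 1 - 2 *\<^sub>R outer v\<close> is the Householder reflection.\<close>

definition outer :: "real ^ 'd::finite \<Rightarrow> real ^ 'd ^ 'd" where
  "outer v = (\<chi> i j. v $ i * v $ j)"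

lemma inner_outer: "outer v \<bullet> H = v \<bullet> (H *v v)"
  by (simp add: outer_def inner_matrix inner_vec_def matrix_vector_mult_def sum_distrib_left ac_simps)

lemma reflection_in_O_group:
  assumes "norm v = 1"
  shows "mat 1 - 2 *\<^sub>R outer v \<in> O_group"
proof -
  have sym: "transpose (outer v) = outer v"
    by (simp add: outer_def transpose_def vec_eq_iff mult.commute)
  have "(\<Sum>k\<in>UNIV. v $ k * v $ k) = 1"
    using assms by (simp add: norm_eq_1 inner_vec_def)
  then have "(\<Sum>k\<in>UNIV. (v $ i * v $ k) * (v $ k * v $ j)) = v $ i * v $ j" for i j
    using sum_distrib_left[of "v $ i * v $ j" "\<lambda>k. v $ k * v $ k" UNIV] by (simp add: ac_simps)
  then have idem: "outer v ** outer v = outer v"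
    by (simp add: outer_def matrix_matrix_mult_def vec_eq_iff)
  show ?thesis
    by (simp add: O_group_def orthogonal_matrix transpose_linear sym matmul.diff_left
        matmul.diff_right matmul.scaleR_left matmul.scaleR_right idem)
      (simp add: vec_eq_iff)
qed

text \<open>Maximality of \<open>Q \<bullet> M\<close> against the rotations \<open>Q exp (s K)\<close> makes \<open>Q\<^sup>T M\<close> symmetric; against the
  reflections it makes \<open>Q\<^sup>T M\<close> positive semidefinite.\<close>

lemma polar_factor:
  fixes M :: "real ^ 'd::finite ^ 'd"
  obtains Q where "Q \<in> O_group" "transpose (transpose Q ** M) = transpose Q ** M"
    "\<And>v. 0 \<le> v \<bullet> ((transpose Q ** M) *v v)"
proof -
  have "(mat 1 :: real ^ 'd ^ 'd) \<in> O_group"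
    by (simp add: O_group_def orthogonal_matrix)
  then have "\<exists>Q\<in>O_group. \<forall>P\<in>O_group. P \<bullet> M \<le> Q \<bullet> M"
    by (intro continuous_attains_sup compact_O_group continuous_intros) auto
  then obtain Q where Q: "Q \<in> O_group" and max: "\<And>P. P \<in> O_group \<Longrightarrow> P \<bullet> M \<le> Q \<bullet> M"
    by blast
  define H where "H = transpose Q ** M"
  have QV: "V \<bullet> H \<le> mat 1 \<bullet> H" if "V \<in> O_group" for V
    using max[of "Q ** V"] inner_matmul_left[of Q V M] inner_matmul_left[of Q "mat 1" M] that Q
    by (simp add: H_def O_group_def orthogonal_matrix_mul)
  have psd: "0 \<le> v \<bullet> (H *v v)" for v
  proof (cases "v = 0")
    case False
    define u where "u = (1 / norm v) *\<^sub>R v"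
    have v: "v = norm v *\<^sub>R u" and u: "norm u = 1"
      using False by (simp_all add: u_def)
    have "0 \<le> u \<bullet> (H *v u)"
      using QV[OF reflection_in_O_group[OF u]] by (simp add: inner_diff_left inner_outer)
    then show ?thesis
      by (subst v, subst (2) v) (simp add: matrix_vector_mult_scaleR)
  qed simp
  define K where "K = H - transpose H"
  have skew: "transpose K = - K"
    by (simp add: K_def transpose_linear)
  have "K \<bullet> H = 0"
  proof -
    \<comment> \<open>This radius keeps \<open>s *\<^sub>R K\<close> within norm 1, where the
      remainder bound of the exponential is available.\<close>
    define r where "r = 1 / (1 + norm K)"
    have r: "0 < r" by (simp add: r_def add_pos_nonneg)
    have "0 \<le> 2 * s * (- (K \<bullet> H) / 2) + s\<^sup>2 * ((norm K)\<^sup>2 * norm H)" if "\<bar>s\<bar> \<le> r" for s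
    proof -
      let ?P = "matrix_exp (s *\<^sub>R K)"
      have "norm (s *\<^sub>R K) \<le> r * norm K"
        using that by (simp add: mult_right_mono)
      also have "\<dots> \<le> 1" by (simp add: r_def add_pos_nonneg)
      finally have small: "norm (s *\<^sub>R K) \<le> 1" .
      have "orthogonal_matrix ?P"
        by (rule orthogonal_matrix_exp) (simp add: transpose_linear skew)
      then have "?P \<bullet> H \<le> mat 1 \<bullet> H" by (intro QV) (simp add: O_group_def)
      then have "(?P - mat 1 - s *\<^sub>R K) \<bullet> H \<le> - s * (K \<bullet> H)"
        by (simp add: inner_diff_left)
      moreover have "\<bar>(?P - mat 1 - s *\<^sub>R K) \<bullet> H\<bar> \<le> (norm (s *\<^sub>R K))\<^sup>2 * norm H"
        by (rule order_trans[OF Cauchy_Schwarz_ineq2])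
          (intro mult_right_mono norm_matrix_exp_remainder small norm_ge_zero)
      ultimately show ?thesis
        by (simp add: power_mult_distrib)
    qed
    from linear_coeff_zero_if_quadratic_nonneg[OF r this] show ?thesis by simp
  qed
  moreover have "K \<bullet> transpose H = - (K \<bullet> H)"
    using inner_transpose[of K "transpose H"] skew by simp
  ultimately have "K \<bullet> K = 0"
    by (simp add: K_def inner_diff_right)
  then have "transpose H = H" by (simp add: K_def)
  with Q psd that show ?thesis unfolding H_def by blast
qed

text \<open>Write \<open>M = Q H\<close> with \<open>H\<close> positive semidefinite and
  \<open>Y = H - 1\<close>. Then \<open>M\<^sup>T M - 1 = Y H + Y\<close>, and the two summands have
  nonnegative inner product, so the sum is at least as long as \<open>Y\<close>.\<close>

lemma polar_factor_near:
  fixes M :: "real ^ 'd::finite ^ 'd"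
  obtains Q where "Q \<in> O_group" "norm (M - Q) \<le> norm (transpose M ** M - mat 1)"
proof -
  obtain Q where Q: "Q \<in> O_group" and sym: "transpose (transpose Q ** M) = transpose Q ** M"
    and psd: "\<And>v. 0 \<le> v \<bullet> ((transpose Q ** M) *v v)"
    using polar_factor[of M] by blast
  define H where "H = transpose Q ** M"
  define Y where "Y = H - mat 1"
  have QQ: "transpose Q ** Q = mat 1" "Q ** transpose Q = mat 1"
    using Q by (auto simp: O_group_def orthogonal_matrix_def)
  have M: "M = Q ** H"
    by (simp add: H_def matrix_mul_assoc QQ)
  have H: "transpose H = H" using sym by (simp add: H_def)
  have "transpose M ** M = H ** (transpose Q ** Q) ** H"
    by (simp add: M matrix_transpose_mul H matrix_mul_assoc)
  also have "\<dots> = H ** H" by (simp add: QQ)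
  finally have "transpose M ** M - mat 1 = Y ** H + Y"
    by (simp add: Y_def matmul.diff_left)
  moreover have "0 \<le> (Y ** H) \<bullet> Y"
  proof -
    have row: "(Y ** H) $ i = H *v (Y $ i)" for i
    proof -
      have "(Y ** H) $ i = (Y ** transpose H) $ i" by (simp add: H)
      also have "\<dots> = H *v (Y $ i)"
        by (simp add: matrix_matrix_mult_def transpose_def matrix_vector_mult_def vec_eq_iff mult.commute)
      finally show ?thesis .
    qed
    have "(Y ** H) \<bullet> Y = (\<Sum>i\<in>UNIV. (Y $ i) \<bullet> (H *v (Y $ i)))"
      unfolding inner_vec_def[of "Y ** H" Y] row by (simp add: inner_commute)
    then show ?thesis using psd by (simp add: H_def sum_nonneg)
  qed
  ultimately have "(norm Y)\<^sup>2 \<le> (norm (transpose M ** M - mat 1))\<^sup>2"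
    by (simp add: power2_norm_eq_inner inner_add_left inner_add_right inner_commute)
  then have "norm Y \<le> norm (transpose M ** M - mat 1)"
    by (rule power2_le_imp_le) simp
  moreover have "M - Q = Q ** Y"
    by (simp add: M Y_def matmul.diff_right)
  ultimately show ?thesis
    using that[OF Q] by (simp add: norm_orthogonal_left QQ)
qed

text \<open>Principal angles: the singular values of \<open>M\<close> are the cosines between the
  column spaces of \<open>G\<close> and \<open>X\<close>. The two residuals, of \<open>X\<close>
  against \<open>G\<close> and of \<open>G\<close> against \<open>X\<close>, involve the same sines,
  hence their equal norms.\<close>

lemma frame_overlap:
  fixes G X :: "real ^ 'd::finite ^ 'm::finite" and N :: real
  assumes N: "0 < N" and G: "transpose G ** G = N *\<^sub>R mat 1" and X: "transpose X ** X = N *\<^sub>R mat 1"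
  defines "M \<equiv> (1 / N) *\<^sub>R (transpose G ** X)"
  defines "P \<equiv> X - G ** M" and "Z \<equiv> G - X ** transpose M"
  shows "transpose G ** P = 0" and "transpose X ** Z = 0"
    and "transpose P ** P = N *\<^sub>R (mat 1 - transpose M ** M)"
    and "transpose Z ** Z = N *\<^sub>R (mat 1 - M ** transpose M)"
    and "(norm P)\<^sup>2 = N * real CARD('d) - N * (norm M)\<^sup>2" and "norm Z = norm P"
proof -
  have GX: "transpose G ** X = N *\<^sub>R M" using N by (simp add: M_def)
  have XG: "transpose X ** G = N *\<^sub>R transpose M"
    using arg_cong[OF GX, of transpose] by (simp add: matrix_transpose_mul transpose_linear)
  show GP: "transpose G ** P = 0"
    by (simp add: P_def matmul.diff_right matrix_mul_assoc G GX matmul.scaleR_left)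
  show XZ: "transpose X ** Z = 0"
    by (simp add: Z_def matmul.diff_right matrix_mul_assoc X XG matmul.scaleR_left)
  have "transpose P ** P = transpose X ** P - transpose M ** (transpose G ** P)"
    by (subst (1) P_def) (simp add: transpose_linear matrix_transpose_mul matmul.diff_left matrix_mul_assoc)
  then show PP: "transpose P ** P = N *\<^sub>R (mat 1 - transpose M ** M)"
    by (simp add: GP matmul.zero_right)
      (simp add: P_def matmul.diff_right matrix_mul_assoc X XG matmul.scaleR_left scaleR_diff_right)
  have "transpose Z ** Z = transpose G ** Z - M ** (transpose X ** Z)"
    by (subst (1) Z_def) (simp add: transpose_linear matrix_transpose_mul matmul.diff_left matrix_mul_assoc)
  then show ZZ: "transpose Z ** Z = N *\<^sub>R (mat 1 - M ** transpose M)"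
    by (simp add: XZ matmul.zero_right)
      (simp add: Z_def matmul.diff_right matrix_mul_assoc G GX matmul.scaleR_left scaleR_diff_right)
  have tr: "(norm A)\<^sup>2 = trace (transpose A ** A)" for A :: "real ^ 'd ^ 'k::finite"
    by (simp add: trace_transpose_matmul power2_norm_eq_inner)
  have sc: "trace (N *\<^sub>R A) = N * trace A" "trace (A - B) = trace A - trace B"
    for A B :: "real ^ 'd ^ 'd"
    by (simp_all add: trace_def sum_distrib_left sum_subtractf)
  show P2: "(norm P)\<^sup>2 = N * real CARD('d) - N * (norm M)\<^sup>2"
    by (simp add: tr PP sc trace_I right_diff_distrib)
  have "(norm Z)\<^sup>2 = N * real CARD('d) - N * (norm (transpose M))\<^sup>2"
    by (simp only: tr ZZ sc trace_I right_diff_distrib transpose_transpose)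
  with P2 have "(norm Z)\<^sup>2 = (norm P)\<^sup>2" by simp
  then show "norm Z = norm P" by (simp only: power2_eq_iff_nonneg norm_ge_zero)
qed

text \<open>The hypothesis exhibits \<open>1 - M M\<^sup>T\<close> as a positive multiple of a Gram
  matrix, so \<open>M\<close> has operator norm at most 1. Using the Frobenius norm of
  \<open>M\<close> instead would cost a factor of order \<open>sqrt d\<close>.\<close>

lemma norm_matmul_contraction:
  fixes M :: "real ^ 'd::finite ^ 'd" and Z :: "real ^ 'd ^ 'm::finite" and A :: "real ^ 'd ^ 'a::finite"
  assumes N: "0 < N" and Z: "transpose Z ** Z = N *\<^sub>R (mat 1 - M ** transpose M)"
  shows "norm (A ** M) \<le> norm A"
proof (rule power2_le_imp_le)
  have "(norm (A ** transpose Z))\<^sup>2 = A \<bullet> (A ** (transpose Z ** Z))"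
    by (simp add: power2_norm_eq_inner inner_matmul_right matrix_mul_assoc)
  also have "\<dots> = N * ((norm A)\<^sup>2 - A \<bullet> (A ** (M ** transpose M)))"
    by (simp add: Z matmul.scaleR_right matmul.diff_right inner_diff_right power2_norm_eq_inner)
  also have "A \<bullet> (A ** (M ** transpose M)) = (norm (A ** M))\<^sup>2"
    by (simp add: power2_norm_eq_inner inner_matmul_right matrix_mul_assoc)
  finally have "0 \<le> N * ((norm A)\<^sup>2 - (norm (A ** M))\<^sup>2)"
    by (metis zero_le_power2)
  then show "(norm (A ** M))\<^sup>2 \<le> (norm A)\<^sup>2"
    using N by (simp add: zero_le_mult_iff)
qed simp

subsection \<open>Top eigenvectors of a low-rank perturbation\<close>

lemma inner_matvec: "(A *v x) \<bullet> y = x \<bullet> (transpose A *v y)"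
  for A :: "real ^ 'a::finite ^ 'b::finite"
  by (metis dot_lmul_matrix inner_commute transpose_matrix_vector transpose_transpose)

text \<open>Maximize the Rayleigh quotient on the unit sphere of \<open>U\<close>. The defect
  \<open>w = m v - A v\<close> lies in \<open>U\<close> by invariance, and varying \<open>v\<close>
  in direction \<open>w\<close> has first-order coefficient \<open>w \<bullet> w\<close>, which must
  vanish.\<close>

lemma symmetric_max_eigenvector:
  fixes A :: "real ^ 'm::finite ^ 'm"
  assumes sym: "transpose A = A" and U: "subspace U" and inv: "\<And>y. y \<in> U \<Longrightarrow> A *v y \<in> U"
    and x: "x \<in> U" "x \<noteq> 0"
  obtains m v where "v \<in> U" "norm v = 1" "A *v v = m *\<^sub>R v"
    "\<And>y. y \<in> U \<Longrightarrow> y \<bullet> (A *v y) \<le> m * (norm y)\<^sup>2"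
proof -
  let ?K = "U \<inter> sphere 0 1"
  have "compact ?K"
    by (intro closed_Int_compact closed_subspace U compact_sphere)
  moreover have "(1 / norm x) *\<^sub>R x \<in> ?K"
    using x U by (auto simp: subspace_scale)
  moreover have "continuous_on ?K (\<lambda>y. y \<bullet> (A *v y))"
    by (intro continuous_intros linear_continuous_on matrix_vector_mul_bounded_linear)
  ultimately obtain v where v: "v \<in> ?K" and max: "\<And>y. y \<in> ?K \<Longrightarrow> y \<bullet> (A *v y) \<le> v \<bullet> (A *v v)"
    using continuous_attains_sup[of ?K "\<lambda>y. y \<bullet> (A *v y)"] by blast
  define m where "m = v \<bullet> (A *v v)"
  have bound: "y \<bullet> (A *v y) \<le> m * (norm y)\<^sup>2" if "y \<in> U" for y
  proof (cases "y = 0")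
    case False
    have "(1 / norm y) *\<^sub>R y \<in> ?K"
      using False that U by (auto simp: subspace_scale)
    from max[OF this] have "(y \<bullet> (A *v y)) / (norm y)\<^sup>2 \<le> m"
      by (simp add: m_def matrix_vector_mult_scaleR power2_eq_square)
    then show ?thesis
      using False by (simp add: pos_divide_le_eq)
  qed simp
  define w where "w = m *\<^sub>R v - A *v v"
  have v1: "v \<bullet> v = 1" "v \<in> U" and w: "w \<in> U"
    using v U inv[of v] by (auto simp: w_def subspace_diff subspace_scale norm_eq_1)
  have vw: "v \<bullet> (A *v w) = w \<bullet> (A *v v)"
    using inner_matvec[of A v w] by (simp add: sym inner_commute)
  have "w \<bullet> w = 0"
  proof (rule linear_coeff_zero_if_quadratic_nonneg)
    fix s :: real
    have "v + s *\<^sub>R w \<in> U"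
      using U v1 w by (simp add: subspace_add subspace_scale)
    note bound[OF this]
    moreover have "(v + s *\<^sub>R w) \<bullet> (A *v (v + s *\<^sub>R w)) = m + 2 * s * (w \<bullet> (A *v v)) + s\<^sup>2 * (w \<bullet> (A *v w))"
      by (simp add: inner_add_left inner_add_right matrix_vector_right_distrib
          matrix_vector_mult_scaleR m_def vw power2_eq_square distrib_left)
    moreover have "(norm (v + s *\<^sub>R w))\<^sup>2 = 1 + 2 * s * (w \<bullet> v) + s\<^sup>2 * (w \<bullet> w)"
      unfolding power2_norm_eq_inner
      by (simp add: inner_add_left inner_add_right v1(1) inner_commute[of v w]
          power2_eq_square distrib_left)
    ultimately have "m + 2 * s * (w \<bullet> (A *v v)) + s\<^sup>2 * (w \<bullet> (A *v w))
        \<le> m * (1 + 2 * s * (w \<bullet> v) + s\<^sup>2 * (w \<bullet> w))"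
      by (simp only:)
    moreover have ww: "w \<bullet> w = m * (w \<bullet> v) - w \<bullet> (A *v v)"
      by (subst (2) w_def) (simp add: inner_diff_right)
    have "2 * s * (w \<bullet> w) = m * (2 * s * (w \<bullet> v)) - 2 * s * (w \<bullet> (A *v v))"
      unfolding ww by (simp add: right_diff_distrib)
    ultimately show "0 \<le> 2 * s * (w \<bullet> w) + s\<^sup>2 * (m * (w \<bullet> w) - w \<bullet> (A *v w))"
      unfolding distrib_left right_diff_distrib by (simp add: mult.left_commute)
  qed (rule zero_less_one)
  then have "A *v v = m *\<^sub>R v" by (simp add: w_def)
  with v bound that show ?thesis by auto
qed

text \<open>Courant-Fischer: if \<open>\<mu> i < c\<close>, then the eigenvectors with eigenvalue at least \<open>c\<close> span a space \<open>V\<close> of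
  dimension at most \<open>i\<close>, so \<open>T\<close> meets its orthogonal complement, and the largest eigenvalue there is at
  least \<open>c\<close>.\<close>

lemma ordered_eigenvalue_ge:
  fixes A :: "real ^ 'm::finite ^ 'm"
  assumes sym: "transpose A = A" and \<mu>: "ordered_eigenvalues A \<mu>"
    and T: "subspace T" "i < dim T" and low: "\<And>x. x \<in> T \<Longrightarrow> c * (norm x)\<^sup>2 \<le> x \<bullet> (A *v x)"
  shows "c \<le> \<mu> i"
proof (rule ccontr)
  assume "\<not> c \<le> \<mu> i"
  have anti: "\<And>j k. j < CARD('m) \<Longrightarrow> k < CARD('m) \<Longrightarrow> j \<le> k \<Longrightarrow> \<mu> k \<le> \<mu> j"
    and mult: "\<And>x. card {j. j < CARD('m) \<and> \<mu> j = x} = dim {v. A *v v = x *\<^sub>R v}"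
    using \<mu> by (auto simp: ordered_eigenvalues_def monotone_on_def)
  have iN: "i < CARD('m)"
    using T(2) dim_subset_UNIV[of T] by simp
  define E where "E x = {v. A *v v = x *\<^sub>R v}" for x
  define F where "F = {x \<in> \<mu> ` {..<CARD('m)}. c \<le> x}"
  have "\<exists>B. B \<subseteq> E x \<and> finite B \<and> E x \<subseteq> span B \<and> card B = dim (E x)" for x
    by (metis basis_exists finiteI_independent)
  then obtain B where B: "\<And>x. B x \<subseteq> E x" "\<And>x. finite (B x)" "\<And>x. E x \<subseteq> span (B x)"
    "\<And>x. card (B x) = dim (E x)"
    by metis
  have finF: "finite F" by (simp add: F_def)
  define W where "W = (\<Union>x\<in>F. B x)"
  have "card W \<le> (\<Sum>x\<in>F. card (B x))"
    unfolding W_def by (rule card_UN_le[OF finF])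
  also have "\<dots> = (\<Sum>x\<in>F. card {j. j < CARD('m) \<and> \<mu> j = x})"
    by (simp add: B(4) mult E_def)
  also have "\<dots> = card (\<Union>x\<in>F. {j. j < CARD('m) \<and> \<mu> j = x})"
    by (rule card_UN_disjoint[symmetric]) (use finF in auto)
  also have "\<dots> \<le> card {..<i}"
  proof (rule card_mono)
    have "j < i" if "j < CARD('m)" "c \<le> \<mu> j" for j
      using anti[OF iN that(1)] that(2) \<open>\<not> c \<le> \<mu> i\<close> by (meson not_le order_trans)
    then show "(\<Union>x\<in>F. {j. j < CARD('m) \<and> \<mu> j = x}) \<subseteq> {..<i}"
      by (auto simp: F_def)
  qed simp
  finally have "dim (span W) \<le> i"
    using dim_le_card'[of W] B(2) finF by (simp add: W_def)
  define U where "U = {y \<in> UNIV. \<forall>x \<in> span W. orthogonal x y}"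
  have dimU: "dim U + dim (span W) = CARD('m)"
    unfolding U_def using dim_subspace_orthogonal_to_vectors[of "span W" UNIV] by simp
  have U: "subspace U"
    unfolding U_def by (simp add: subspace_orthogonal_to_vectors)
  have "dim {x + y |x y. x \<in> T \<and> y \<in> U} \<le> CARD('m)"
    using dim_subset_UNIV[of "{x + y |x y. x \<in> T \<and> y \<in> U}"] by simp
  with dim_sums_Int[OF T(1) U] dimU T(2) \<open>dim (span W) \<le> i\<close> have "dim (T \<inter> U) \<noteq> 0"
    by linarith
  then obtain x where x: "x \<in> T" "x \<in> U" "x \<noteq> 0"
    by (auto simp: dim_eq_0)
  have inv: "A *v y \<in> U" if "y \<in> U" for y
  proof -
    have "orthogonal (A *v y) b" if b: "b \<in> W" for b
    proof -
      obtain x where "b \<in> E x" using b B(1) by (auto simp: W_def)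
      then have "(A *v y) \<bullet> b = x * (y \<bullet> b)"
        using inner_matvec[of A y b] by (simp add: sym E_def)
      also have "y \<bullet> b = 0"
        using \<open>y \<in> U\<close> span_base[OF b] by (auto simp: U_def orthogonal_def inner_commute)
      finally show ?thesis by (simp add: orthogonal_def)
    qed
    then have "orthogonal (A *v y) x" if "x \<in> span W" for x
      using that by (blast intro: orthogonal_to_span)
    then show ?thesis
      by (simp add: U_def orthogonal_commute)
  qed
  obtain m v where v: "v \<in> U" "norm v = 1" "A *v v = m *\<^sub>R v"
    and max: "\<And>y. y \<in> U \<Longrightarrow> y \<bullet> (A *v y) \<le> m * (norm y)\<^sup>2"
    using symmetric_max_eigenvector[OF sym U inv x(2,3)] by blast
  have "c * (norm x)\<^sup>2 \<le> m * (norm x)\<^sup>2"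
    using low[OF x(1)] max[OF x(2)] by linarith
  then have "c \<le> m" using x(3) by simp
  have "v \<in> E m" "v \<noteq> 0" using v by (auto simp: E_def)
  then have "dim (E m) \<noteq> 0" by (auto simp: dim_eq_0)
  \<comment> \<open>By the multiplicity clause a nontrivial eigenspace forces its eigenvalue to
    occur in the list; thus \<open>v\<close> lies in the span of \<open>W\<close> while being
    orthogonal to it.\<close>
  then have "{j. j < CARD('m) \<and> \<mu> j = m} \<noteq> {}"
    using mult[of m] by (metis E_def card.empty)
  then have "m \<in> F" using \<open>c \<le> m\<close> by (auto simp: F_def)
  then have "v \<in> span W"
    using B(3)[of m] \<open>v \<in> E m\<close> span_mono[of "B m" W] by (auto simp: W_def)
  then have "orthogonal v v" using v(1) by (auto simp: U_def)
  then show False using \<open>v \<noteq> 0\<close> by (simp add: orthogonal_def)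
qed

text \<open>The range of \<open>G\<close> is the test space for Courant-Fischer: it has dimension d
  since \<open>G\<close> is injective, and on it \<open>G G\<^sup>T\<close> acts as multiplication
  by \<open>N\<close>. All of the first d eigenvalues are bounded, so the order chosen by
  \<open>\<sigma>\<close> is irrelevant.\<close>

lemma top_eigenvectors_low_rank_perturbation:
  fixes G \<Phi> :: "real ^ 'd::finite ^ 'm::finite" and \<Delta> :: "real ^ 'm ^ 'm"
  assumes N: "0 < N" and G: "transpose G ** G = N *\<^sub>R mat 1" and sym: "transpose \<Delta> = \<Delta>"
    and top: "top_eigenvectors (G ** transpose G + \<Delta>) \<Phi>"
  obtains \<nu> where "\<And>j. N - op_norm \<Delta> \<le> \<nu> j"
    "(G ** transpose G + \<Delta>) ** \<Phi> = \<Phi> ** (\<chi> i j. if i = j then \<nu> j else 0)"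
proof -
  define C where "C = G ** transpose G + \<Delta>"
  obtain \<mu> \<sigma> where \<mu>: "ordered_eigenvalues C \<mu>" and \<sigma>: "bij_betw \<sigma> (UNIV :: 'd set) {..<CARD('d)}"
    and ev: "\<And>j. C *v column j \<Phi> = \<mu> (\<sigma> j) *\<^sub>R column j \<Phi>"
    using top unfolding top_eigenvectors_def C_def by blast
  have C: "transpose C = C"
    by (simp add: C_def transpose_linear matrix_transpose_mul sym)
  define T where "T = range (\<lambda>y. G *v y)"
  have GG: "transpose G *v (G *v y) = N *\<^sub>R y" for y
    by (simp only: matrix_vector_mul_assoc G scaleR_matrix_vector_assoc[symmetric] matrix_vector_mul_lid)
  have "inj (\<lambda>y. G *v y)"
    using N by (metis (no_types, lifting) GG injI less_irrefl scaleR_cancel_left)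
  then have dimT: "dim T = CARD('d)"
    unfolding T_def by (subst dim_image_eq) auto
  have T: "subspace T"
    unfolding T_def by (intro linear_subspace_image subspace_UNIV) simp
  have low: "(N - op_norm \<Delta>) * (norm x)\<^sup>2 \<le> x \<bullet> (C *v x)" if "x \<in> T" for x
  proof -
    obtain y where x: "x = G *v y" using \<open>x \<in> T\<close> by (auto simp: T_def)
    have "x \<bullet> (G *v (transpose G *v x)) = N * (norm x)\<^sup>2"
      unfolding x GG by (simp add: matrix_vector_mult_scaleR power2_norm_eq_inner)
    moreover have "\<bar>x \<bullet> (\<Delta> *v x)\<bar> \<le> norm x * (op_norm \<Delta> * norm x)"
      by (rule order_trans[OF Cauchy_Schwarz_ineq2])
        (intro mult_left_mono norm_matvec_le_op norm_ge_zero)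
    moreover have "x \<bullet> (C *v x) = x \<bullet> (G *v (transpose G *v x)) + x \<bullet> (\<Delta> *v x)"
      by (simp only: C_def matrix_vector_mult_add_rdistrib matrix_vector_mul_assoc[symmetric]
          inner_add_right)
    moreover have "norm x * (op_norm \<Delta> * norm x) = op_norm \<Delta> * (norm x)\<^sup>2"
      by (simp add: power2_eq_square)
    ultimately show ?thesis
      unfolding left_diff_distrib by linarith
  qed
  show thesis
  proof
    show "N - op_norm \<Delta> \<le> \<mu> (\<sigma> j)" for j
    proof (rule ordered_eigenvalue_ge[OF C \<mu> T _ low])
      show "\<sigma> j < dim T" using \<sigma> dimT by (auto simp: bij_betw_def)
    qed
    have "(C ** \<Phi>) $ r $ j = \<mu> (\<sigma> j) * \<Phi> $ r $ j" for r j
      using arg_cong[OF ev[of j], of "\<lambda>v. v $ r"] unfolding column_matmul[symmetric]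
      by (simp add: column_def)
    then show "(G ** transpose G + \<Delta>) ** \<Phi> = \<Phi> ** (\<chi> i j. if i = j then \<mu> (\<sigma> j) else 0)"
      by (simp add: C_def[symmetric] vec_eq_iff matrix_matrix_mult_def[of \<Phi>] if_distrib mult.commute
          cong: if_cong)
  qed
qed

text \<open>This inverts the eigenvalue matrix in the eigenvector equation. The row type is
  arbitrary because the equation is inverted both for a whole column and for a single block.\<close>

lemma norm_matmul_diagonal_ge:
  fixes Y :: "real ^ 'd::finite ^ 'm::finite"
  assumes "0 \<le> l" "\<And>j. l \<le> \<nu> j"
  shows "l * norm Y \<le> norm (Y ** (\<chi> i j. if i = j then \<nu> j else 0))"
proof (rule power2_le_imp_le)
  have "(norm M)\<^sup>2 = (\<Sum>r\<in>UNIV. \<Sum>j\<in>UNIV. (M $ r $ j)\<^sup>2)" for M :: "real ^ 'd ^ 'm"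
    unfolding power2_norm_eq_inner inner_matrix by (simp add: power2_eq_square)
  moreover have "(l * Y $ r $ j)\<^sup>2 \<le> (Y $ r $ j * \<nu> j)\<^sup>2" for r j
    using power_mono[OF assms(2)[of j] assms(1), of 2]
    by (simp add: power_mult_distrib mult.commute mult_right_mono)
  ultimately show "(l * norm Y)\<^sup>2 \<le> (norm (Y ** (\<chi> i j. if i = j then \<nu> j else 0)))\<^sup>2"
    by (simp add: power_mult_distrib[of l "norm Y"] sum_distrib_left matrix_matrix_mult_def if_distrib
        power_mult_distrib cong: if_cong)
      (intro sum_mono, simp add: power_mult_distrib)
qed simp

text \<open>On the segment from \<open>P\<close> to \<open>B\<close> the matrices
  \<open>P (1 + s E)\<close> with \<open>norm E < 1\<close> stay invertible, so by the intermediate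
  value theorem the determinant cannot change sign.\<close>

lemma det_pos_of_near_orthogonal:
  fixes P B :: "real ^ 'd::finite ^ 'd"
  assumes P: "orthogonal_matrix P" and near: "norm (B - P) < 1" and B: "0 < det B"
  shows "0 < det P"
proof -
  define E where "E = transpose P ** (B - P)"
  have PE: "P ** E = B - P" "norm E < 1"
    using P near norm_orthogonal_left[of "transpose P" "B - P"]
    by (simp_all add: E_def matrix_mul_assoc orthogonal_matrix_def)
  have nz: "det (mat 1 + s *\<^sub>R E) \<noteq> 0" if "0 \<le> s" "s \<le> 1" for s
  proof
    assume "det (mat 1 + s *\<^sub>R E) = 0"
    then obtain v where v: "v \<noteq> 0" "(mat 1 + s *\<^sub>R E) *v v = 0"
      using invertible_det_nz invertible_left_inverse matrix_left_invertible_ker by metis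
    then have "v = - (s *\<^sub>R (E *v v))"
      by (simp add: matrix_vector_mult_add_rdistrib scaleR_matrix_vector_assoc[symmetric]
          eq_neg_iff_add_eq_0)
    then have "norm v = s * norm (E *v v)"
      using that by (metis abs_of_nonneg norm_minus_cancel norm_scaleR)
    also have "\<dots> \<le> 1 * (norm E * norm v)"
    proof (intro mult_mono)
      show "norm (E *v v) \<le> norm E * norm v"
        \<comment> \<open>The vector is read as a matrix with a single column.\<close>
        using norm_matmul_le[of E "\<chi> i. \<chi> j::1. v $ i"]
        by (simp add: norm_vec_def L2_set_def matrix_matrix_mult_def matrix_vector_mult_def)
    qed (use that in auto)
    also have "\<dots> < norm v" using PE(2) v(1) by simp
    finally show False by simp
  qed
  have cont: "continuous_on {0..1} (\<lambda>s. det (mat 1 + s *\<^sub>R E))"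
    unfolding det_def by (auto intro!: continuous_intros)
  have "0 < det (mat 1 + 1 *\<^sub>R E)"
  proof (rule ccontr)
    assume "\<not> 0 < det (mat 1 + 1 *\<^sub>R E)"
    then have "\<exists>s\<ge>0. s \<le> 1 \<and> det (mat 1 + s *\<^sub>R E) = 0"
      by (intro IVT2' cont) auto
    then show False using nz by blast
  qed
  moreover have "B = P ** (mat 1 + 1 *\<^sub>R E)"
    using PE(1) by (simp add: matrix_add_ldistrib)
  ultimately show ?thesis
    using B by (simp add: det_mul zero_less_mult_iff)
qed

subsection \<open>The synchronization setting and spectral initialization\<close>

lemma O_groupD:
  assumes "Q \<in> O_group"
  shows "transpose Q ** Q = mat 1" "Q ** transpose Q = mat 1"
  using assms by (auto simp: O_group_def orthogonal_matrix_def)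

lemma O_group_mult: "P \<in> O_group \<Longrightarrow> Q \<in> O_group \<Longrightarrow> P ** Q \<in> O_group"
  by (simp add: O_group_def orthogonal_matrix_mul)

lemma O_blocks_frame:
  fixes X :: "('n::finite, 'd::finite) bcol"
  assumes "X \<in> blocks_in O_group"
  shows "transpose X ** X = real CARD('n) *\<^sub>R mat 1"
  using assms
  by (simp add: block_transpose_matmul blocks_in_def O_groupD(1) sum_constant_scaleR del: sum_constant)

text \<open>\<open>q\<close> is the fourth root of the number of blocks, so that the operator norm bound of the theorem
  reads \<open>op_norm \<Delta> \<le> q\<^sup>3 / (80 * sqrt d)\<close>.\<close>

locale synchronization =
  fixes Gs :: "('n::finite, 'd::finite) bcol" and \<Delta> C :: "('n, 'd) bmat" and n d q :: real
  assumes n_def: "n = real CARD('n)" and d_def: "d = real CARD('d)"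
    and Gs: "Gs \<in> blocks_in O_group"
    and \<Delta>_sym: "transpose \<Delta> = \<Delta>"
    and C_def: "C = Gs ** transpose Gs + \<Delta>"
    and q: "1 \<le> q" "q ^ 4 = n"
    and \<Delta>_op: "op_norm \<Delta> * (80 * sqrt d) \<le> q ^ 3"
    and \<Delta>_sup: "norm (block (\<Delta> ** Gs) i) \<le> n / 400"
begin

definition overlap :: "('n, 'd) bcol \<Rightarrow> real ^ 'd ^ 'd" where
  "overlap X = (1 / n) *\<^sub>R (transpose Gs ** X)"

definition perp :: "('n, 'd) bcol \<Rightarrow> ('n, 'd) bcol" where
  "perp X = X - Gs ** overlap X"

text \<open>The deviation of \<open>Gs\<close> from the column space of \<open>X\<close>. It has the
  same norm as \<open>perp X\<close> and is used where \<open>Gs\<close> has to be expressed through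
  \<open>X\<close>.\<close>

definition coperp :: "('n, 'd) bcol \<Rightarrow> ('n, 'd) bcol" where
  "coperp X = Gs - X ** transpose (overlap X)"

lemma n_pos: "0 < n" and d_pos: "0 < d" and n_ge_1: "1 \<le> n" and d_ge_1: "1 \<le> d"
  by (simp_all add: n_def d_def)

lemma Gs_frame: "transpose Gs ** Gs = n *\<^sub>R mat 1"
  unfolding n_def by (rule O_blocks_frame[OF Gs])

lemma Gs_block: "block Gs i \<in> O_group"
  using Gs by (simp add: blocks_in_def)

lemma C_sym: "transpose C = C"
  by (simp add: C_def transpose_linear matrix_transpose_mul \<Delta>_sym)

lemma q_powers: "q \<le> q\<^sup>2" "q\<^sup>2 \<le> n" "q ^ 3 \<le> n" "q \<le> n" "0 < q"
  using q(1) power_increasing[of 1 2 q] power_increasing[of 2 4 q] power_increasing[of 3 4 q]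
    power_increasing[of 1 4 q] by (simp_all add: q(2)[symmetric])

lemma op_norm_\<Delta>_le_q: "80 * op_norm \<Delta> \<le> q ^ 3"
proof -
  have "op_norm \<Delta> * 80 \<le> op_norm \<Delta> * (80 * sqrt d)"
    using d_ge_1 op_norm_nonneg[of \<Delta>] by (intro mult_left_mono) auto
  with \<Delta>_op show ?thesis by linarith
qed

lemma op_norm_\<Delta>_le: "80 * op_norm \<Delta> \<le> n"
  using op_norm_\<Delta>_le_q q_powers(3) by linarith

lemma frame_norm:
  fixes X :: "('n, 'd) bcol"
  assumes "transpose X ** X = n *\<^sub>R mat 1"
  shows "norm X = q\<^sup>2 * sqrt d"
proof -
  have "(norm X)\<^sup>2 = trace (transpose X ** X)"
    by (simp add: trace_transpose_matmul power2_norm_eq_inner)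
  also have "\<dots> = n * d"
    unfolding assms by (simp add: trace_def mat_def d_def)
  also have "\<dots> = (q\<^sup>2 * sqrt d)\<^sup>2"
    using d_pos by (simp add: power_mult_distrib q(2)[symmetric] power_mult[symmetric])
  finally show ?thesis
    by (rule power2_eq_imp_eq) (use d_pos in auto)
qed

text \<open>The \<open>sqrt d\<close> in the hypothesis on \<open>op_norm \<Delta>\<close> absorbs
  the norm \<open>q\<^sup>2 * sqrt d\<close> of a frame; what remains is free of the
  dimension.\<close>

lemma norm_\<Delta>_frame:
  fixes X :: "('n, 'd) bcol"
  assumes "transpose X ** X = n *\<^sub>R mat 1"
  shows "norm (\<Delta> ** X) \<le> q ^ 5 / 80"
proof -
  have "norm (\<Delta> ** X) \<le> op_norm \<Delta> * (q\<^sup>2 * sqrt d)"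
    using norm_matmul_le_op[of \<Delta> X] frame_norm[OF assms] by simp
  also have "\<dots> = q\<^sup>2 * (op_norm \<Delta> * (80 * sqrt d)) / 80" by simp
  also have "\<dots> \<le> q\<^sup>2 * q ^ 3 / 80"
    using \<Delta>_op by (intro divide_right_mono mult_left_mono) auto
  finally show ?thesis by (simp add: power_add[symmetric])
qed

lemmas frame_overlap_facts =
  frame_overlap[OF n_pos Gs_frame, folded overlap_def d_def, folded perp_def coperp_def]

lemma norm_overlap_contraction:
  assumes "transpose X ** X = n *\<^sub>R mat 1"
  shows "norm (A ** overlap X) \<le> norm A"
  using norm_matmul_contraction[OF n_pos frame_overlap_facts(4)[OF assms]] .

lemma norm_block_Gs: "norm (block Gs i ** A) = norm A"
  by (rule norm_orthogonal_left[OF O_groupD(1)[OF Gs_block]])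

lemma block_perp: "block (perp X) i = block X i - block Gs i ** overlap X"
  by (simp add: perp_def block_linear block_matmul)

lemma perp_linear: "perp (X + Y) = perp X + perp Y" "perp (X - Y) = perp X - perp Y"
  by (simp_all add: perp_def overlap_def matmul.add_right matmul.diff_right scaleR_add_right
      scaleR_diff_right)

lemma perp_matmul: "perp (X ** A) = perp X ** A"
  by (simp add: perp_def overlap_def matmul.diff_left matmul.scaleR_left matmul.scaleR_right matrix_mul_assoc)

lemma perp_Gs: "perp Gs = 0"
  using n_pos by (simp add: perp_def overlap_def Gs_frame)

lemma norm_perp_le: "norm (perp X) \<le> norm X"
proof (rule power2_le_imp_le)
  have "(Gs ** overlap X) \<bullet> (Gs ** overlap X) = n * (overlap X \<bullet> overlap X)"
    by (simp add: inner_matmul_left matrix_mul_assoc Gs_frame matmul.scaleR_left)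
  moreover have "(Gs ** overlap X) \<bullet> X = n * (overlap X \<bullet> overlap X)"
    using n_pos by (simp add: inner_matmul_left) (simp add: overlap_def)
  ultimately have "(norm (perp X))\<^sup>2 = (norm X)\<^sup>2 - n * (overlap X \<bullet> overlap X)"
    by (simp add: perp_def power2_norm_eq_inner inner_diff_left inner_diff_right
        inner_commute[of X "Gs ** overlap X"])
  then show "(norm (perp X))\<^sup>2 \<le> (norm X)\<^sup>2" using n_pos by simp
qed simp

lemma norm_average_le:
  fixes f :: "'n \<Rightarrow> 'v::real_normed_vector"
  assumes "\<And>i. norm (f i) \<le> c"
  shows "norm ((1 / n) *\<^sub>R (\<Sum>i\<in>UNIV. f i)) \<le> c"
proof -
  have "norm (\<Sum>i\<in>UNIV. f i) \<le> n * c"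
    using sum_norm_le[of UNIV f "\<lambda>_. c"] assms by (simp add: n_def)
  then show ?thesis using n_pos by (simp add: pos_divide_le_eq mult.commute)
qed

lemma norm_block_perp_le:
  assumes "\<And>i. norm (block X i) \<le> c"
  shows "norm (block (perp X) i) \<le> 2 * c"
proof -
  have "norm (overlap X) \<le> c"
    unfolding overlap_def block_transpose_matmul
  proof (rule norm_average_le)
    show "norm (transpose (block Gs i) ** block X i) \<le> c" for i
      using assms[of i] norm_orthogonal_left[of "transpose (block Gs i)" "block X i"]
      by (simp add: O_groupD(2)[OF Gs_block])
  qed
  then show ?thesis
    using norm_triangle_ineq4[of "block X i" "block Gs i ** overlap X"] assms[of i]
    by (simp add: block_perp norm_block_Gs)
qed

text \<open>The component of \<open>X\<close> along \<open>Gs\<close> falls under the blockwise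
  hypothesis, since right multiplication by the overlap is a contraction. The rest is paid with the
  operator norm, where \<open>q ^ 3 * q = n\<close>.\<close>

lemma norm_block_noise:
  assumes X: "transpose X ** X = n *\<^sub>R mat 1" and c: "norm (perp X) \<le> c * q"
  shows "norm (block (\<Delta> ** X) i) \<le> n * (1 / 400 + c / 80)"
proof -
  have "X = Gs ** overlap X + perp X" by (simp add: perp_def)
  then have "block (\<Delta> ** X) i = block (\<Delta> ** Gs) i ** overlap X + block (\<Delta> ** perp X) i"
    using block_linear(1)[of "\<Delta> ** (Gs ** overlap X)" "\<Delta> ** perp X" i]
    by (simp only: matrix_add_ldistrib[symmetric] matrix_mul_assoc[symmetric] block_matmul[symmetric])
  then have "norm (block (\<Delta> ** X) i)
      \<le> norm (block (\<Delta> ** Gs) i ** overlap X) + norm (block (\<Delta> ** perp X) i)"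
    by (simp add: norm_triangle_ineq)
  moreover have "norm (block (\<Delta> ** Gs) i ** overlap X) \<le> n / 400"
    using norm_overlap_contraction[OF X] \<Delta>_sup by (rule order_trans)
  moreover have "norm (block (\<Delta> ** perp X) i) \<le> n * (c / 80)"
  proof -
    have "norm (block (\<Delta> ** perp X) i) \<le> op_norm \<Delta> * norm (perp X)"
      using norm_block_le norm_matmul_le_op by (rule order_trans)
    also have "\<dots> \<le> (q ^ 3 / 80) * (c * q)"
      using op_norm_\<Delta>_le_q q_powers(5) by (intro mult_mono c) auto
    also have "\<dots> = n * (c / 80)"
      by (simp add: q(2)[symmetric] power_numeral_reduce)
    finally show ?thesis .
  qed
  ultimately show ?thesis by (simp add: distrib_left)
qed

text \<open>\<open>perp\<close> annihilates the signal and commutes with multiplication from the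
  right, so the eigenvector equation becomes
  \<open>perp \<Phi> ** \<Lambda> = perp (\<Delta> ** \<Phi>)\<close> with all eigenvalues at least
  \<open>n * (79 / 80)\<close>. The Frobenius bound comes first and then feeds the noise estimate
  behind the blockwise one.\<close>

lemma spectral_estimates:
  assumes top: "top_eigenvectors C \<Phi>" and \<Phi>: "transpose \<Phi> ** \<Phi> = n *\<^sub>R mat 1"
  shows "norm (perp \<Phi>) \<le> q / 79" and "norm (block (perp \<Phi>) i) \<le> 11 / 2000"
proof -
  obtain \<nu> where \<nu>: "\<And>j. n - op_norm \<Delta> \<le> \<nu> j"
    and eig: "C ** \<Phi> = \<Phi> ** (\<chi> i j. if i = j then \<nu> j else 0)"
    using top_eigenvectors_low_rank_perturbation[OF n_pos Gs_frame \<Delta>_sym, of \<Phi>] top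
    by (auto simp: C_def)
  define \<Lambda> :: "real ^ 'd ^ 'd" where "\<Lambda> = (\<chi> i j. if i = j then \<nu> j else 0)"
  define l where "l = n * (79 / 80)"
  have l: "0 < l" "\<And>j. l \<le> \<nu> j"
    using \<nu> op_norm_\<Delta>_le n_pos by (auto simp: l_def) (smt (verit))
  have \<Lambda>: "l * norm Y \<le> norm (Y ** \<Lambda>)" for Y :: "real ^ 'd ^ 'm::finite"
    unfolding \<Lambda>_def using l by (intro norm_matmul_diagonal_ge) auto
  have "perp (Gs ** (transpose Gs ** \<Phi>)) = 0"
    by (simp add: perp_matmul perp_Gs matmul.zero_left)
  then have eq: "perp \<Phi> ** \<Lambda> = perp (\<Delta> ** \<Phi>)"
    using arg_cong[OF eig, of perp]
    by (simp add: C_def \<Lambda>_def matmul.add_left perp_linear perp_matmul matrix_mul_assoc[symmetric])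
  have "l * norm (perp \<Phi>) \<le> q ^ 5 / 80"
    using \<Lambda>[of "perp \<Phi>"] norm_perp_le[of "\<Delta> ** \<Phi>"] norm_\<Delta>_frame[OF \<Phi>] by (simp add: eq)
  also have "\<dots> = l * (q / 79)"
    by (simp add: l_def q(2)[symmetric] power_numeral_reduce)
  finally show dev: "norm (perp \<Phi>) \<le> q / 79"
    using l(1) by simp
  have "norm (block (\<Delta> ** \<Phi>) i) \<le> n * (1 / 400 + (1 / 79) / 80)" for i
    using dev by (intro norm_block_noise \<Phi>) simp
  from norm_block_perp_le[OF this]
  have "norm (block (perp \<Phi> ** \<Lambda>) i) \<le> 2 * (n * (1 / 400 + (1 / 79) / 80))"
    unfolding eq .
  with \<Lambda>[of "block (perp \<Phi>) i"] have "l * norm (block (perp \<Phi>) i) \<le> n * (2 * (1 / 400 + (1 / 79) / 80))"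
    by (simp add: block_matmul)
  also have "\<dots> \<le> l * (11 / 2000)"
    unfolding l_def mult.assoc using n_pos by (intro mult_left_mono) auto
  finally show "norm (block (perp \<Phi>) i) \<le> 11 / 2000"
    using l(1) by simp
qed

lemma initialization:
  assumes group: "\<G> = O_group \<or> \<G> = SO_group" and Gs_group: "Gs \<in> blocks_in \<G>"
    and top: "top_eigenvectors C \<Phi>" and \<Phi>: "transpose \<Phi> ** \<Phi> = n *\<^sub>R mat 1"
    and oriented: "\<G> = SO_group \<Longrightarrow> \<exists>i. 0 < det (block \<Phi> i)"
    and proj: "is_block_projection \<G> \<Phi> G0"
  shows "G0 \<in> blocks_in O_group" and "norm (perp G0) \<le> q / 38" and "norm (block (perp G0) i) \<le> 1 / 10"
proof -
  note est = spectral_estimates[OF top \<Phi>]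
  have G0: "block G0 i \<in> \<G>"
    and nearest: "\<And>Q. Q \<in> \<G> \<Longrightarrow> norm (block \<Phi> i - block G0 i) \<le> norm (block \<Phi> i - Q)" for i
    using proj by (auto simp: is_block_projection_def is_arg_min_def not_less)
  show "G0 \<in> blocks_in O_group"
    using G0 group by (auto simp: blocks_in_def SO_group_def O_group_def rotation_matrix_def)
  obtain Q where Q: "Q \<in> O_group"
    and MQ0: "norm (overlap \<Phi> - Q) \<le> norm (transpose (overlap \<Phi>) ** overlap \<Phi> - mat 1)"
    using polar_factor_near[of "overlap \<Phi>"] by blast
  note MQ0
  also have "\<dots> = norm ((1 / n) *\<^sub>R (transpose (perp \<Phi>) ** perp \<Phi>))"
    using n_pos by (simp add: frame_overlap_facts(3)[OF \<Phi>] norm_minus_commute)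
  also have "\<dots> \<le> (q / 79)\<^sup>2 / n"
  proof -
    have "norm (transpose (perp \<Phi>) ** perp \<Phi>) \<le> (norm (perp \<Phi>))\<^sup>2"
      using norm_matmul_le[of "transpose (perp \<Phi>)" "perp \<Phi>"] by (simp add: power2_eq_square)
    also have "\<dots> \<le> (q / 79)\<^sup>2" by (intro power_mono est norm_ge_zero)
    finally show ?thesis using n_pos by (simp add: divide_right_mono)
  qed
  \<comment> \<open>The constant is \<open>1 / 79\<^sup>2\<close>. The decay in \<open>q\<close> is
    essential: \<open>Gs\<close> multiplies this error by \<open>q\<^sup>2\<close>, which leaves
    only a constant in the Frobenius estimate below.\<close>
  finally have MQ: "norm (overlap \<Phi> - Q) \<le> 1 / 6241 / q\<^sup>2"
    using q_powers(5) by (simp add: q(2)[symmetric] power_divide field_simps power_numeral_reduce)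
  also have "\<dots> \<le> 1 / 6241"
    using q(1) by (simp add: divide_simps)
  finally have MQ1: "norm (overlap \<Phi> - Q) \<le> 1 / 6241" .
  have split: "\<Phi> - Gs ** Q = perp \<Phi> + Gs ** (overlap \<Phi> - Q)"
    by (simp add: perp_def matmul.diff_right)
  have near: "norm (block \<Phi> i - block Gs i ** Q) \<le> 1 / 170" for i
  proof -
    have "norm (block (\<Phi> - Gs ** Q) i) \<le> norm (block (perp \<Phi>) i) + norm (overlap \<Phi> - Q)"
      unfolding split block_linear block_matmul
      by (rule order_trans[OF norm_triangle_ineq]) (simp add: norm_block_Gs)
    then show ?thesis
      using est(2)[of i] MQ1 by (simp add: block_linear block_matmul)
  qed
  \<comment> \<open>The comparison point must lie in the group to compete with the nearest point.
    For SO(d), a single block of \<open>\<Phi>\<close> with positive determinant already settles the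
    sign of \<open>det Q\<close>.\<close>
  have GsQ: "block Gs i ** Q \<in> \<G>" for i
  proof (cases "\<G> = SO_group")
    case True
    from oriented[OF True] obtain j where "0 < det (block \<Phi> j)" by blast
    moreover have "norm (block \<Phi> j - block Gs j ** Q) < 1"
      using near[of j] by linarith
    moreover have "orthogonal_matrix (block Gs j ** Q)"
      using O_group_mult[OF Gs_block Q] by (simp add: O_group_def)
    ultimately have "0 < det (block Gs j ** Q)"
      using det_pos_of_near_orthogonal by blast
    moreover have det: "det (block Gs k) = 1" for k
      using Gs_group by (auto simp: True blocks_in_def SO_group_def rotation_matrix_def)
    ultimately have "det Q = 1"
      using det_orthogonal_matrix[of Q] Q by (auto simp: det_mul O_group_def)
    then show ?thesis
      using O_group_mult[OF Gs_block Q, of i]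
      by (simp add: True SO_group_def O_group_def rotation_matrix_def det_mul det)
  next
    case False
    with group O_group_mult[OF Gs_block Q] show ?thesis by auto
  qed
  \<comment> \<open>A nearest point is no farther from \<open>\<Phi>\<close> than the competitor
    \<open>Gs Q\<close>, so projecting at most doubles the distance to \<open>Gs Q\<close>.\<close>
  have blk: "norm (block (G0 - Gs ** Q) i) \<le> 2 * norm (block (\<Phi> - Gs ** Q) i)" for i
  proof -
    have "block G0 i - block Gs i ** Q = (block \<Phi> i - block Gs i ** Q) - (block \<Phi> i - block G0 i)"
      by simp
    then have "norm (block G0 i - block Gs i ** Q)
        \<le> norm (block \<Phi> i - block Gs i ** Q) + norm (block \<Phi> i - block G0 i)"
      by (metis norm_triangle_ineq4)
    with nearest[OF GsQ[of i], of i] show ?thesis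
      by (simp add: block_linear block_matmul)
  qed
  have perp_G0: "perp G0 = perp (G0 - Gs ** Q)"
    by (simp add: perp_linear perp_matmul perp_Gs matmul.zero_left)
  have "norm (block (G0 - Gs ** Q) i) \<le> 1 / 85" for i
    using blk[of i] near[of i] by (simp add: block_linear block_matmul)
  from norm_block_perp_le[OF this, of i] show "norm (block (perp G0) i) \<le> 1 / 10"
    unfolding perp_G0 by simp
  have "(norm (G0 - Gs ** Q))\<^sup>2 \<le> (2 * norm (\<Phi> - Gs ** Q))\<^sup>2"
    unfolding sq_norm_block power_mult_distrib[of 2] sum_distrib_left
    by (rule sum_mono) (use power_mono[OF blk, of _ 2] in \<open>simp add: power_mult_distrib\<close>)
  then have "norm (G0 - Gs ** Q) \<le> 2 * norm (\<Phi> - Gs ** Q)"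
    by (rule power2_le_imp_le) simp
  also have "\<dots> \<le> 2 * (norm (perp \<Phi>) + norm (Gs ** (overlap \<Phi> - Q)))"
    unfolding split by (intro mult_left_mono norm_triangle_ineq) simp
  also have "norm (Gs ** (overlap \<Phi> - Q)) = q\<^sup>2 * norm (overlap \<Phi> - Q)"
  proof (rule power2_eq_imp_eq)
    show "(norm (Gs ** (overlap \<Phi> - Q)))\<^sup>2 = (q\<^sup>2 * norm (overlap \<Phi> - Q))\<^sup>2"
      by (simp add: power2_norm_eq_inner inner_matmul_left matrix_mul_assoc Gs_frame
          matmul.scaleR_left power_mult_distrib q(2)[symmetric] power_mult[symmetric])
  qed auto
  also have "\<dots> \<le> 1 / 6241"
    using MQ q_powers(5) by (simp add: field_simps)
  finally have "norm (G0 - Gs ** Q) \<le> q / 38"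
    using est(1) q(1) by simp
  then show "norm (perp G0) \<le> q / 38"
    unfolding perp_G0 using norm_perp_le order_trans by blast
qed

end

subsection \<open>One gradient step\<close>

context synchronization
begin

text \<open>The block of \<open>C ** X\<close> seen in the frame of \<open>X\<^sub>i\<close>, close
  to \<open>n\<close> times the identity near the orbit. Its symmetric part is the
  multiplier.\<close>

definition local_form :: "('n, 'd) bcol \<Rightarrow> 'n \<Rightarrow> real ^ 'd ^ 'd" where
  "local_form X i = transpose (block X i) ** block (C ** X) i"

definition skew_part :: "('n, 'd) bcol \<Rightarrow> 'n \<Rightarrow> real ^ 'd ^ 'd" where
  "skew_part X i = (1 / 2) *\<^sub>R (local_form X i - transpose (local_form X i))"

definition sym_part :: "('n, 'd) bcol \<Rightarrow> 'n \<Rightarrow> real ^ 'd ^ 'd" where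
  "sym_part X i = (1 / 2) *\<^sub>R (local_form X i + transpose (local_form X i))"

text \<open>Half of the Riemannian gradient when the blocks are orthogonal, which explains the
  factor 2 in \<open>step\<close>.\<close>

definition residual :: "('n, 'd) bcol \<Rightarrow> ('n, 'd) bcol" where
  "residual X = stack (\<lambda>i. block X i ** skew_part X i)"

definition step :: "('n, 'd) bcol \<Rightarrow> real \<Rightarrow> ('n, 'd) bcol" where
  "step X t = stack (\<lambda>i. block X i ** matrix_exp ((2 * t) *\<^sub>R skew_part X i))"

text \<open>The invariant of the iteration: \<open>q / 18\<close> is what ascent guarantees from a
  start within \<open>q / 38\<close>, and \<open>1 / 10\<close> is a level that one step
  reproduces.\<close>

definition good :: "('n, 'd) bcol \<Rightarrow> bool" where
  "good X \<longleftrightarrow> X \<in> blocks_in O_group \<and> norm (perp X) \<le> q / 18 \<and> (\<forall>i. norm (block (perp X) i) \<le> 1 / 10)"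

lemma skew_part_skew: "transpose (skew_part X i) = - skew_part X i"
  by (simp add: skew_part_def transpose_linear flip: scaleR_minus_right)

lemma sym_part_sym: "transpose (sym_part X i) = sym_part X i"
  by (simp add: sym_part_def transpose_linear add.commute)

lemma sym_plus_skew: "sym_part X i + skew_part X i = local_form X i"
  by (simp add: sym_part_def skew_part_def vec_eq_iff algebra_simps)

lemma step_in_O:
  assumes "X \<in> blocks_in O_group"
  shows "step X t \<in> blocks_in O_group"
proof -
  have "matrix_exp ((2 * t) *\<^sub>R skew_part X i) \<in> O_group" for i
    unfolding O_group_def
    by (intro CollectI orthogonal_matrix_exp) (simp add: transpose_linear skew_part_skew)
  with assms show ?thesis
    by (simp add: blocks_in_def step_def O_group_mult)
qed

lemma riemannian_step:
  assumes "X \<in> blocks_in O_group"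
  shows "riemannian_exp X (t *\<^sub>R riemannian_grad C X) = step X t"
proof -
  have E: "transpose (block X i) ** block (C ** X) i - transpose (block (C ** X) i) ** block X i
      = 2 *\<^sub>R skew_part X i" for i
    by (simp add: skew_part_def local_form_def matrix_transpose_mul)
  have "t *\<^sub>R riemannian_grad C X = stack (\<lambda>i. block X i ** ((2 * t) *\<^sub>R skew_part X i))"
    by (rule block_eqI)
      (simp add: riemannian_grad_tangent(1)[OF assms] E block_linear matmul.scaleR_right mult.commute)
  then show ?thesis
    by (simp add: riemannian_exp_tangent[OF assms] step_def)
qed

lemma O_blockD:
  assumes "X \<in> blocks_in O_group"
  shows "transpose (block X i) ** block X i = mat 1" "block X i ** transpose (block X i) = mat 1"
    "norm (block X i ** A) = norm A" "norm (transpose (block X i) ** A) = norm A"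
proof -
  have "block X i \<in> O_group" using assms by (simp add: blocks_in_def)
  note * = O_groupD[OF this]
  show "transpose (block X i) ** block X i = mat 1" "block X i ** transpose (block X i) = mat 1"
    by (fact *)+
  show "norm (block X i ** A) = norm A" "norm (transpose (block X i) ** A) = norm A"
    by (simp_all add: norm_orthogonal_left *)
qed

lemma sq_norm_residual:
  assumes "X \<in> blocks_in O_group"
  shows "(norm (residual X))\<^sup>2 = (\<Sum>i\<in>UNIV. (norm (skew_part X i))\<^sup>2)"
  by (simp add: sq_norm_block residual_def O_blockD(3)[OF assms])

lemma norm_skew_sym_le:
  fixes A :: "real ^ 'd ^ 'd"
  shows "norm ((1 / 2) *\<^sub>R (A - transpose A)) \<le> norm A" "norm ((1 / 2) *\<^sub>R (A + transpose A)) \<le> norm A"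
  using norm_triangle_ineq4[of A "transpose A"] norm_triangle_ineq[of A "transpose A"] by simp_all

lemma block_C_matmul:
  "block (C ** X) i = n *\<^sub>R (block Gs i ** overlap X) + block (\<Delta> ** X) i"
proof -
  have "C ** X = n *\<^sub>R (Gs ** overlap X) + \<Delta> ** X"
    using n_pos by (simp add: C_def overlap_def matmul.add_left matmul.scaleR_right matrix_mul_assoc)
  then show ?thesis by (simp add: block_linear block_matmul)
qed

lemma local_form_eq:
  assumes "X \<in> blocks_in O_group"
  shows "local_form X i = n *\<^sub>R (mat 1 - transpose (block X i) ** block (perp X) i)
      + transpose (block X i) ** block (\<Delta> ** X) i"
proof -
  have "block Gs i ** overlap X = block X i - block (perp X) i"
    by (simp add: block_perp)
  then show ?thesis
    by (simp add: local_form_def block_C_matmul matmul.add_right matmul.scaleR_right matmul.diff_right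
        O_blockD(1)[OF assms])
qed

lemma good_frame: "good X \<Longrightarrow> transpose X ** X = n *\<^sub>R mat 1"
  using O_blocks_frame[of X, folded n_def] by (simp add: good_def)

lemma good_noise: "norm (block (\<Delta> ** X) i) \<le> n / 250" if "good X"
proof -
  have "norm (block (\<Delta> ** X) i) \<le> n * (1 / 400 + (1 / 18) / 80)"
    using that by (intro norm_block_noise good_frame) (auto simp: good_def)
  also have "\<dots> \<le> n * (1 / 250)"
    using n_pos by (intro mult_left_mono) auto
  finally show ?thesis by simp
qed

lemma local_form_near:
  assumes "good X"
  shows "norm (local_form X i - n *\<^sub>R mat 1) \<le> n * (norm (block (perp X) i) + 1 / 250)"
proof -
  have O: "X \<in> blocks_in O_group" using assms by (simp add: good_def)
  have "local_form X i - n *\<^sub>R mat 1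
      = transpose (block X i) ** (block (\<Delta> ** X) i - n *\<^sub>R block (perp X) i)"
    by (simp add: local_form_eq[OF O] matmul.diff_right matmul.scaleR_right scaleR_diff_right)
  then have "norm (local_form X i - n *\<^sub>R mat 1) \<le> norm (block (\<Delta> ** X) i) + norm (n *\<^sub>R block (perp X) i)"
    by (simp only: O_blockD(4)[OF O] norm_triangle_ineq4)
  then show ?thesis
    using good_noise[OF assms, of i] n_pos by (simp add: distrib_left)
qed

lemma skew_part_eq: "skew_part X i
    = (1 / 2) *\<^sub>R ((local_form X i - n *\<^sub>R mat 1) - transpose (local_form X i - n *\<^sub>R mat 1))"
  by (simp add: skew_part_def transpose_linear)

lemma norm_skew_part_le:
  assumes "good X"
  shows "norm (skew_part X i) \<le> n * (norm (block (perp X) i) + 1 / 250)"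
  unfolding skew_part_eq by (rule order_trans[OF norm_skew_sym_le(1) local_form_near[OF assms]])

lemma step_size_bounds:
  assumes X: "good X" and t: "0 \<le> t" "t * n \<le> 1 / 4"
  defines "E \<equiv> \<lambda>i. (2 * t) *\<^sub>R skew_part X i"
  shows "norm (E i) \<le> 2 * (t * n) * (norm (block (perp X) i) + 1 / 250)" and "norm (E i) \<le> 1 / 10"
    and "norm (matrix_exp (E i) - mat 1 - E i) \<le> (norm (E i))\<^sup>2"
    and "norm (matrix_exp (E i) - mat 1) \<le> 11 / 10 * norm (E i)"
proof -
  have p: "norm (block (perp X) i) \<le> 1 / 10" using X by (simp add: good_def)
  have "norm (E i) = 2 * t * norm (skew_part X i)" using t by (simp add: E_def)
  also have "\<dots> \<le> 2 * t * (n * (norm (block (perp X) i) + 1 / 250))"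
    using t by (intro mult_left_mono norm_skew_part_le X) auto
  finally show E: "norm (E i) \<le> 2 * (t * n) * (norm (block (perp X) i) + 1 / 250)"
    by (simp add: mult.assoc)
  also have "\<dots> \<le> 2 * (1 / 4) * (1 / 10 + 1 / 250)"
    using t p n_pos by (intro mult_mono) auto
  finally show E1: "norm (E i) \<le> 1 / 10" by simp
  then show rem: "norm (matrix_exp (E i) - mat 1 - E i) \<le> (norm (E i))\<^sup>2"
    by (intro norm_matrix_exp_remainder) simp
  have "norm (matrix_exp (E i) - mat 1) \<le> norm (matrix_exp (E i) - mat 1 - E i) + norm (E i)"
    using norm_triangle_ineq[of "matrix_exp (E i) - mat 1 - E i" "E i"] by simp
  moreover have "(norm (E i))\<^sup>2 \<le> 1 / 10 * norm (E i)"
    unfolding power2_eq_square using E1 by (intro mult_right_mono) auto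
  ultimately show "norm (matrix_exp (E i) - mat 1) \<le> 11 / 10 * norm (E i)"
    using rem by simp
qed

lemma norm_step_diff:
  assumes X: "good X" and t: "0 \<le> t" "t * n \<le> 1 / 4"
  shows "(norm (step X t - X))\<^sup>2 \<le> 5 * t\<^sup>2 * (norm (residual X))\<^sup>2"
proof -
  have O: "X \<in> blocks_in O_group" using X by (simp add: good_def)
  have "(norm (block (step X t - X) i))\<^sup>2 \<le> 5 * t\<^sup>2 * (norm (skew_part X i))\<^sup>2" for i
  proof -
    have "block (step X t - X) i = block X i ** (matrix_exp ((2 * t) *\<^sub>R skew_part X i) - mat 1)"
      by (simp add: step_def block_linear matmul.diff_right)
    then have "norm (block (step X t - X) i) \<le> 11 / 10 * norm ((2 * t) *\<^sub>R skew_part X i)"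
      using step_size_bounds(4)[OF X t, of i] by (simp only: O_blockD(3)[OF O])
    then have "(norm (block (step X t - X) i))\<^sup>2 \<le> (11 / 10 * norm ((2 * t) *\<^sub>R skew_part X i))\<^sup>2"
      by (rule power_mono) simp
    also have "\<dots> = (484 / 100) * (t\<^sup>2 * (norm (skew_part X i))\<^sup>2)"
      using t(1) by (simp add: power_mult_distrib power_divide)
    also have "\<dots> \<le> 5 * (t\<^sup>2 * (norm (skew_part X i))\<^sup>2)"
      by (intro mult_right_mono) auto
    finally show ?thesis by simp
  qed
  then show ?thesis
    unfolding sq_norm_block sq_norm_residual[OF O, unfolded sq_norm_block] sum_distrib_left
    by (intro sum_mono)
qed

text \<open>In \<open>p \<le> 1/36 + 9 p\<^sup>2\<close> the weights are balanced so that both terms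
  sum to at most \<open>n / 36\<close>. This mean bound is sharper than the uniform
  \<open>1 / 10\<close> and limits the drift of the overlap.\<close>

lemma sum_norm_block_perp:
  assumes "good X"
  shows "(\<Sum>i\<in>UNIV. norm (block (perp X) i)) \<le> n / 18"
proof -
  have "(\<Sum>i\<in>UNIV. norm (block (perp X) i)) \<le> (\<Sum>i\<in>UNIV. 1 / 36 + 9 * (norm (block (perp X) i))\<^sup>2)"
  proof (rule sum_mono)
    fix i
    have "0 \<le> (1 / 6 - 3 * norm (block (perp X) i))\<^sup>2" by simp
    then show "norm (block (perp X) i) \<le> 1 / 36 + 9 * (norm (block (perp X) i))\<^sup>2"
      by (simp add: power2_eq_square algebra_simps)
  qed
  also have "\<dots> = n / 36 + 9 * (norm (perp X))\<^sup>2"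
    by (simp add: sum.distrib n_def[symmetric] sq_norm_block[of "perp X"] sum_distrib_left)
  also have "(norm (perp X))\<^sup>2 \<le> (q / 18)\<^sup>2"
    using assms by (intro power_mono) (auto simp: good_def)
  finally show ?thesis
    using q_powers(2) by (simp add: power_divide)
qed

text \<open>\<open>H = X\<^sub>i\<^sup>T P\<^sub>i\<close> is skew up to a small second-order term
  \<open>\<Sigma>\<close>, so the step essentially multiplies \<open>P\<^sub>i\<close> by
  \<open>1 - 2 \<tau>\<close> with \<open>\<tau> = t n\<close>. At level \<open>1 / 10\<close> this
  gains \<open>\<tau> / 5\<close>. Every error is proportional to \<open>\<tau>\<close> as well, so
  arbitrarily small steps are covered.\<close>

lemma block_perp_step:
  assumes X: "good X" and t: "0 \<le> t" "t * n \<le> 1 / 4"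
  shows "norm (block (perp (step X t)) i) \<le> 1 / 10"
proof -
  have O: "X \<in> blocks_in O_group" using X by (simp add: good_def)
  define E where "E i = (2 * t) *\<^sub>R skew_part X i" for i
  define P where "P i = block (perp X) i" for i
  define D where "D i = block (\<Delta> ** X) i" for i
  define \<tau> where "\<tau> = t * n"
  note E = step_size_bounds[OF X t, folded E_def, folded P_def \<tau>_def]
  have \<tau>: "0 \<le> \<tau>" "\<tau> \<le> 1 / 4" using t n_pos by (auto simp: \<tau>_def)
  have P: "norm (P i) \<le> 1 / 10" using X by (simp add: good_def P_def)
  have drift: "norm (overlap (step X t) - overlap X) \<le> 11 / 5 * \<tau> * (1 / 18 + 1 / 250)"
  proof -
    have "overlap (step X t) - overlap X
        = (1 / n) *\<^sub>R (\<Sum>i\<in>UNIV. transpose (block Gs i) ** (block X i ** (matrix_exp (E i) - mat 1)))"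
      by (simp add: overlap_def block_transpose_matmul step_def E_def[symmetric]
          matmul.diff_right sum_subtractf scaleR_diff_right)
    then have "norm (overlap (step X t) - overlap X)
        \<le> (1 / n) * (\<Sum>i\<in>UNIV. norm (transpose (block Gs i) ** (block X i ** (matrix_exp (E i) - mat 1))))"
      using n_pos by (simp add: divide_right_mono norm_sum)
    also have "\<dots> = (1 / n) * (\<Sum>i\<in>UNIV. norm (matrix_exp (E i) - mat 1))"
      by (simp only: O_blockD(3)[OF O] O_blockD(4)[OF Gs])
    also have "\<dots> \<le> (1 / n) * (\<Sum>i\<in>UNIV. 11 / 5 * \<tau> * (norm (P i) + 1 / 250))"
    proof (intro mult_left_mono sum_mono)
      show "norm (matrix_exp (E i) - mat 1) \<le> 11 / 5 * \<tau> * (norm (P i) + 1 / 250)" for i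
        using E(1)[of i] E(4)[of i] by (simp add: algebra_simps)
    qed (use n_pos in auto)
    also have "\<dots> = (1 / n) * (11 / 5 * \<tau> * ((\<Sum>i\<in>UNIV. norm (P i)) + n / 250))"
      by (simp only: sum_distrib_left[symmetric] sum.distrib) (simp add: n_def[symmetric])
    also have "\<dots> \<le> (1 / n) * (11 / 5 * \<tau> * (n / 18 + n / 250))"
      using sum_norm_block_perp[OF X] n_pos \<tau> by (intro mult_left_mono add_right_mono) (auto simp: P_def)
    also have "\<dots> = 11 / 5 * \<tau> * (1 / 18 + 1 / 250)"
      using n_pos by (simp add: field_simps)
    finally show ?thesis .
  qed
  \<comment> \<open>Computing \<open>M\<^sup>T M\<close> once from block \<open>i\<close> and once
    from the whole column gives
    \<open>\<Sigma> = (1 - M\<^sup>T M) + P\<^sub>i\<^sup>T P\<^sub>i\<close>, and both terms are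
    quadratic in the deviation.\<close>
  define \<Sigma> where "\<Sigma> = transpose (block X i) ** P i + transpose (transpose (block X i) ** P i)"
  have Sigma: "norm \<Sigma> \<le> 1 / 324 + 1 / 100"
  proof -
    let ?M = "overlap X"
    have Xi: "block Gs i ** ?M = block X i - P i" by (simp add: P_def block_perp)
    have "transpose ?M ** ?M = transpose (block Gs i ** ?M) ** (block Gs i ** ?M)"
      by (simp add: matrix_transpose_mul matrix_mul_assoc)
        (simp add: matrix_mul_assoc[symmetric] O_blockD(1)[OF Gs])
    also have "\<dots> = mat 1 - \<Sigma> + transpose (P i) ** P i"
      unfolding Xi by (simp add: \<Sigma>_def transpose_linear matmul.diff_left matmul.diff_right
          O_blockD(1)[OF O] matrix_transpose_mul)
    finally have "\<Sigma> = (mat 1 - transpose ?M ** ?M) + transpose (P i) ** P i" by simp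
    also have "mat 1 - transpose ?M ** ?M = (1 / n) *\<^sub>R (transpose (perp X) ** perp X)"
      using n_pos by (simp add: frame_overlap_facts(3)[OF good_frame[OF X]])
    finally have "norm \<Sigma> \<le> norm ((1 / n) *\<^sub>R (transpose (perp X) ** perp X)) + norm (transpose (P i) ** P i)"
      by (simp only: norm_triangle_ineq)
    moreover have "norm ((1 / n) *\<^sub>R (transpose (perp X) ** perp X)) \<le> 1 / 324"
    proof -
      have "norm (transpose (perp X) ** perp X) \<le> norm (perp X) * norm (perp X)"
        using norm_matmul_le[of "transpose (perp X)" "perp X"] by simp
      also have "\<dots> \<le> (q / 18) * (q / 18)"
        using X q_powers(5) by (intro mult_mono) (auto simp: good_def)
      also have "\<dots> \<le> n / 324" using q_powers(2) by (simp add: power2_eq_square)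
      finally show ?thesis using n_pos by (simp add: pos_divide_le_eq)
    qed
    moreover have "norm (transpose (P i) ** P i) \<le> 1 / 100"
    proof -
      have "norm (transpose (P i) ** P i) \<le> norm (P i) * norm (P i)"
        using norm_matmul_le[of "transpose (P i)" "P i"] by simp
      also have "\<dots> \<le> (1 / 10) * (1 / 10)" using P by (intro mult_mono) auto
      finally show ?thesis by simp
    qed
    ultimately show ?thesis by simp
  qed
  define K where "K = (1 / 2) *\<^sub>R (transpose (block X i) ** D i - transpose (transpose (block X i) ** D i))"
  have K: "norm K \<le> n / 250"
    using norm_skew_sym_le(1)[of "transpose (block X i) ** D i"] good_noise[OF X, of i]
    unfolding K_def by (simp only: O_blockD(4)[OF O] D_def)
  define H where "H = transpose (block X i) ** P i"
  have "skew_part X i = K - (n / 2) *\<^sub>R (H - transpose H)"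
    by (simp add: skew_part_def local_form_eq[OF O] K_def H_def D_def P_def transpose_linear vec_eq_iff
        algebra_simps)
  moreover have "H - transpose H = 2 *\<^sub>R H - \<Sigma>"
    by (simp add: \<Sigma>_def H_def scaleR_2)
  ultimately have Ei: "E i = (2 * t) *\<^sub>R K - (2 * \<tau>) *\<^sub>R H + \<tau> *\<^sub>R \<Sigma>"
    by (simp add: E_def \<tau>_def scaleR_diff_right)
  have XH: "block X i ** H = P i"
    by (simp add: H_def matrix_mul_assoc O_blockD(2)[OF O])
  have "block (perp (step X t)) i = (1 - 2 * \<tau>) *\<^sub>R P i
      + (block X i ** (\<tau> *\<^sub>R \<Sigma> + (2 * t) *\<^sub>R K + (matrix_exp (E i) - mat 1 - E i))
         - block Gs i ** (overlap (step X t) - overlap X))"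
  proof -
    have "block X i ** matrix_exp (E i) = block X i + block X i ** E i
        + block X i ** (matrix_exp (E i) - mat 1 - E i)"
      by (simp add: matmul.diff_right)
    moreover have "block X i ** E i = block X i ** (\<tau> *\<^sub>R \<Sigma> + (2 * t) *\<^sub>R K) - (2 * \<tau>) *\<^sub>R P i"
      unfolding Ei by (simp add: matmul.diff_right matmul.add_right matmul.scaleR_right XH)
    moreover have "block (perp (step X t)) i = block X i ** matrix_exp (E i) - block Gs i ** overlap (step X t)"
      by (simp add: block_perp step_def E_def)
    moreover have "P i = block X i - block Gs i ** overlap X"
      by (simp add: P_def block_perp)
    ultimately show ?thesis
      by (simp add: matmul.diff_right matmul.add_right scaleR_diff_left)
  qed
  moreover have tri: "norm (U + (V - W)) \<le> norm U + (norm V + norm W)" for U V W :: "real ^ 'd ^ 'd"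
    using norm_triangle_ineq[of U "V - W"] norm_triangle_ineq4[of V W] by linarith
  ultimately have "norm (block (perp (step X t)) i) \<le> norm ((1 - 2 * \<tau>) *\<^sub>R P i)
      + (norm (\<tau> *\<^sub>R \<Sigma> + (2 * t) *\<^sub>R K + (matrix_exp (E i) - mat 1 - E i))
         + norm (overlap (step X t) - overlap X))"
    by (metis O_blockD(3)[OF O] norm_block_Gs)
  also have "norm ((1 - 2 * \<tau>) *\<^sub>R P i) \<le> (1 - 2 * \<tau>) * (1 / 10)"
    using \<tau> P by (simp add: mult_left_mono)
  also have "norm (\<tau> *\<^sub>R \<Sigma> + (2 * t) *\<^sub>R K + (matrix_exp (E i) - mat 1 - E i))
      \<le> norm (\<tau> *\<^sub>R \<Sigma>) + norm ((2 * t) *\<^sub>R K) + norm (matrix_exp (E i) - mat 1 - E i)"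
    by (meson add_right_mono norm_triangle_ineq order_trans)
  also have "norm (\<tau> *\<^sub>R \<Sigma>) \<le> \<tau> * (1 / 324 + 1 / 100)"
    using mult_left_mono[OF Sigma \<tau>(1)] \<tau>(1) by (simp only: norm_scaleR abs_of_nonneg)
  also have "norm ((2 * t) *\<^sub>R K) \<le> \<tau> * (2 / 250)"
    using mult_left_mono[OF K t(1)] t(1) by (simp add: \<tau>_def)
  also have "norm (matrix_exp (E i) - mat 1 - E i) \<le> \<tau> * (104 / 1000)\<^sup>2"
  proof -
    have "norm (E i) \<le> 2 * \<tau> * (104 / 1000)"
      by (rule order_trans[OF E(1)]) (use P \<tau> in \<open>intro mult_left_mono, auto\<close>)
    then have "(norm (E i))\<^sup>2 \<le> (2 * \<tau> * (104 / 1000))\<^sup>2"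
      by (rule power_mono) simp
    also have "\<dots> = \<tau> * (4 * \<tau>) * (104 / 1000)\<^sup>2"
      by (simp add: power2_eq_square)
    also have "\<dots> \<le> \<tau> * 1 * (104 / 1000)\<^sup>2"
      using \<tau> by (intro mult_right_mono mult_left_mono) auto
    finally show ?thesis using E(3)[of i] by simp
  qed
  also note drift
  \<comment> \<open>The last coefficient, about 0.163, collects \<open>\<Sigma>\<close>, the noise,
    the exponential remainder and the drift; the drift alone accounts for 0.131.\<close>
  finally have "norm (block (perp (step X t)) i) \<le> 1 / 10 - 1 / 5 * \<tau> + 412403 / 2531250 * \<tau>"
    by (simp add: power2_eq_square field_simps)
  also have "\<dots> \<le> 1 / 10"
    using \<tau>(1) by simp
  finally show ?thesis .
qed

end

subsection \<open>Ascent, gradient dominance and convergence\<close>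

context synchronization
begin

lemma inner_C_matmul: "Y \<bullet> (C ** Z) = (transpose Gs ** Y) \<bullet> (transpose Gs ** Z) + Y \<bullet> (\<Delta> ** Z)"
proof -
  have "Y \<bullet> (Gs ** (transpose Gs ** Z)) = (transpose Gs ** Y) \<bullet> (transpose Gs ** Z)"
    using inner_matmul_left[of "transpose Gs" Y "transpose Gs ** Z"] by simp
  then show ?thesis
    by (simp add: C_def matmul.add_left inner_add_right matrix_mul_assoc)
qed

lemma inner_C_commute: "Y \<bullet> (C ** Z) = (C ** Y) \<bullet> Z"
  by (simp add: inner_matmul_left C_sym)

lemma abs_inner_\<Delta>_le: "\<bar>Y \<bullet> (\<Delta> ** Y)\<bar> \<le> n / 80 * (norm Y)\<^sup>2"
proof -
  have "\<bar>Y \<bullet> (\<Delta> ** Y)\<bar> \<le> norm Y * (op_norm \<Delta> * norm Y)"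
    by (rule order_trans[OF Cauchy_Schwarz_ineq2]) (intro mult_left_mono norm_matmul_le_op norm_ge_zero)
  also have "\<dots> = op_norm \<Delta> * (norm Y)\<^sup>2" by (simp add: power2_eq_square)
  also have "\<dots> \<le> n / 80 * (norm Y)\<^sup>2"
    using op_norm_\<Delta>_le by (intro mult_right_mono) auto
  finally show ?thesis .
qed

lemma inner_skew_part: "(local_form X i - n *\<^sub>R mat 1) \<bullet> skew_part X i = (norm (skew_part X i))\<^sup>2"
proof -
  have "mat 1 \<bullet> skew_part X i = 0" "sym_part X i \<bullet> skew_part X i = 0"
    by (auto intro!: inner_symmetric_skew simp: skew_part_skew sym_part_sym)
  then show ?thesis
    by (simp add: sym_plus_skew[symmetric] inner_diff_left inner_add_left power2_norm_eq_inner)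
qed

text \<open>The objective is quadratic, so the increase is \<open>2 (V \<bullet> C V')\<close> with
  \<open>V' = X\<close>, plus \<open>V \<bullet> C V\<close>; the latter can be negative only
  through the noise. In the linear term the identity part of \<open>local_form\<close> is of second
  order, and the skew part supplies the gain.\<close>

lemma sufficient_ascent:
  assumes X: "good X" and t: "0 \<le> t" "t * n \<le> 1 / 4"
  shows "objective C X + 2 * t * (norm (residual X))\<^sup>2 \<le> objective C (step X t)"
proof -
  have O: "X \<in> blocks_in O_group" using X by (simp add: good_def)
  define V where "V = step X t - X"
  have blk: "(129 / 100) * t * (norm (skew_part X i))\<^sup>2 \<le> block V i \<bullet> block (C ** X) i" for i
  proof -
    define E where "E = (2 * t) *\<^sub>R skew_part X i"
    define Y where "Y = local_form X i - n *\<^sub>R mat 1"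
    let ?R = "matrix_exp E - mat 1"
    note E = step_size_bounds[OF X t, of i, folded E_def]
    have "orthogonal_matrix (matrix_exp E)"
      by (rule orthogonal_matrix_exp) (simp add: E_def transpose_linear skew_part_skew)
    then have one: "mat 1 \<bullet> ?R = - (1 / 2) * (norm ?R)\<^sup>2"
      using sq_norm_diff_mat_1[of "matrix_exp E"] by simp
    have "norm Y \<le> n * (104 / 1000)"
    proof (rule order_trans[OF local_form_near[OF X, of i, folded Y_def]])
      have "norm (block (perp X) i) \<le> 1 / 10" using X by (simp add: good_def)
      then show "n * (norm (block (perp X) i) + 1 / 250) \<le> n * (104 / 1000)"
        using n_pos by (intro mult_left_mono) auto
    qed
    then have "\<bar>Y \<bullet> (?R - E)\<bar> \<le> n * (104 / 1000) * (norm E)\<^sup>2"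
      by (intro order_trans[OF Cauchy_Schwarz_ineq2] mult_mono E(3)) (use n_pos in auto)
    then have "\<bar>Y \<bullet> (?R - E)\<bar> \<le> 104 / 1000 * (n * (norm E)\<^sup>2)" by simp
    moreover have "Y \<bullet> E = 2 * t * (norm (skew_part X i))\<^sup>2"
      by (simp add: E_def Y_def inner_skew_part)
    moreover have "(norm ?R)\<^sup>2 \<le> (11 / 10 * norm E)\<^sup>2"
      by (rule power_mono[OF E(4)]) simp
    then have "n * (norm ?R)\<^sup>2 \<le> n * (121 / 100 * (norm E)\<^sup>2)"
      using n_pos by (intro mult_left_mono) (auto simp: power_mult_distrib power_divide)
    then have "n * (norm ?R)\<^sup>2 \<le> 121 / 100 * (n * (norm E)\<^sup>2)" by simp
    moreover have "local_form X i \<bullet> ?R = n * (mat 1 \<bullet> ?R) + Y \<bullet> E + Y \<bullet> (?R - E)"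
      by (simp add: Y_def inner_diff_left inner_diff_right algebra_simps)
    then have "local_form X i \<bullet> ?R = - (1 / 2) * (n * (norm ?R)\<^sup>2) + Y \<bullet> E + Y \<bullet> (?R - E)"
      unfolding one by simp
    \<comment> \<open>Here 0.709 is 0.104 from the exponential remainder plus half of
      \<open>(11/10)\<^sup>2\<close> from the identity part; the bound \<open>t n \<le> 1/4\<close>
      then leaves more than 1.29 of the initial 2.\<close>
    ultimately have "2 * t * (norm (skew_part X i))\<^sup>2 - 709 / 1000 * (n * (norm E)\<^sup>2) \<le> local_form X i \<bullet> ?R"
      by linarith
    moreover have "n * (norm E)\<^sup>2 \<le> t * (norm (skew_part X i))\<^sup>2"
    proof -
      have "n * (norm E)\<^sup>2 = (4 * (t * n)) * (t * (norm (skew_part X i))\<^sup>2)"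
        by (simp add: E_def power_mult_distrib power2_eq_square)
      also have "\<dots> \<le> 1 * (t * (norm (skew_part X i))\<^sup>2)"
        using t by (intro mult_right_mono) auto
      finally show ?thesis by simp
    qed
    ultimately have "(129 / 100) * t * (norm (skew_part X i))\<^sup>2 \<le> local_form X i \<bullet> ?R"
      using mult_nonneg_nonneg[OF t(1), of "(norm (skew_part X i))\<^sup>2"] by simp
    also have "local_form X i \<bullet> ?R = block V i \<bullet> block (C ** X) i"
    proof -
      have "block V i = block X i ** ?R"
        by (simp add: V_def step_def E_def block_linear matmul.diff_right)
      then show ?thesis
        by (simp only: local_form_def inner_matmul_left inner_commute[of _ ?R])
    qed
    finally show ?thesis .
  qed
  define w where "w = t * (norm (residual X))\<^sup>2"
  have w: "0 \<le> w" using t by (simp add: w_def)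
  have "129 / 100 * w = (\<Sum>i\<in>UNIV. (129 / 100) * t * (norm (skew_part X i))\<^sup>2)"
    by (simp add: w_def sq_norm_residual[OF O] sum_distrib_left mult.assoc)
  also have "\<dots> \<le> V \<bullet> (C ** X)"
    unfolding inner_block[of V] by (intro sum_mono blk)
  finally have lin: "129 / 100 * w \<le> V \<bullet> (C ** X)" .
  have "\<bar>V \<bullet> (\<Delta> ** V)\<bar> \<le> n / 80 * (5 * t\<^sup>2 * (norm (residual X))\<^sup>2)"
    using norm_step_diff[OF X t] n_pos
    by (intro order_trans[OF abs_inner_\<Delta>_le] mult_left_mono) (auto simp: V_def)
  also have "\<dots> = (t * n) * (w / 16)"
    by (simp add: w_def power2_eq_square)
  also have "\<dots> \<le> 1 / 4 * (w / 16)"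
    using t w by (intro mult_right_mono) auto
  finally have "- w / 64 \<le> V \<bullet> (C ** V)"
    using inner_ge_zero[of "transpose Gs ** V"] unfolding inner_C_matmul[of V V] by linarith
  moreover have "objective C (step X t) = objective C X + 2 * (V \<bullet> (C ** X)) + V \<bullet> (C ** V)"
  proof -
    have "step X t = X + V" by (simp add: V_def)
    then show ?thesis
      using inner_C_commute[of X V]
      by (simp add: objective_inner matmul.add_right inner_add_left inner_add_right inner_commute)
  qed
  ultimately show ?thesis
    using lin w by (simp add: w_def)
qed

section \<open>Superlevel sets of the objective\<close>

lemma objective_frame:
  assumes X: "transpose X ** X = n *\<^sub>R mat 1"
  shows "objective C X = n\<^sup>2 * d - n * (norm (perp X))\<^sup>2 + X \<bullet> (\<Delta> ** X)"
    and "\<bar>X \<bullet> (\<Delta> ** X) - Gs \<bullet> (\<Delta> ** Gs)\<bar> \<le> q ^ 5 / 40 * norm (perp X)"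
proof -
  have "transpose Gs ** X = n *\<^sub>R overlap X" using n_pos by (simp add: overlap_def)
  then have "(transpose Gs ** X) \<bullet> (transpose Gs ** X) = n * (n * (norm (overlap X))\<^sup>2)"
    by (simp add: power2_norm_eq_inner)
  also have "n * (norm (overlap X))\<^sup>2 = n * d - (norm (perp X))\<^sup>2"
    using frame_overlap_facts(5)[OF X] by simp
  finally show "objective C X = n\<^sup>2 * d - n * (norm (perp X))\<^sup>2 + X \<bullet> (\<Delta> ** X)"
    by (simp add: objective_inner inner_C_matmul right_diff_distrib power2_eq_square)
  have sym: "Y \<bullet> (\<Delta> ** Z) = (\<Delta> ** Y) \<bullet> Z" for Y Z :: "('n, 'd) bcol"
    by (simp add: inner_matmul_left \<Delta>_sym)
  have "X \<bullet> (\<Delta> ** X) = (\<Delta> ** X) \<bullet> perp X + (\<Delta> ** X) \<bullet> (Gs ** overlap X)"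
    by (simp add: perp_def inner_diff_right inner_commute)
  also have "(\<Delta> ** X) \<bullet> (Gs ** overlap X) = (\<Delta> ** Gs) \<bullet> (X ** transpose (overlap X))"
    using sym[of X "Gs ** overlap X"] inner_matmul_right[of "\<Delta> ** Gs" "overlap X" X]
    by (simp add: matrix_mul_assoc inner_commute)
  also have "X ** transpose (overlap X) = Gs - coperp X" by (simp add: coperp_def)
  \<comment> \<open>Moving the overlap from one factor to the other cancels the common part, so the
    change of the noise term is linear in two residuals of equal norm.\<close>
  finally have "X \<bullet> (\<Delta> ** X) - Gs \<bullet> (\<Delta> ** Gs) = (\<Delta> ** X) \<bullet> perp X - (\<Delta> ** Gs) \<bullet> coperp X"
    by (simp add: inner_diff_right inner_commute)
  moreover have "\<bar>(\<Delta> ** X) \<bullet> perp X\<bar> \<le> q ^ 5 / 80 * norm (perp X)"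
    by (rule order_trans[OF Cauchy_Schwarz_ineq2]) (intro mult_right_mono norm_\<Delta>_frame X norm_ge_zero)
  moreover have "\<bar>(\<Delta> ** Gs) \<bullet> coperp X\<bar> \<le> q ^ 5 / 80 * norm (perp X)"
    unfolding frame_overlap_facts(6)[OF X, symmetric]
    by (rule order_trans[OF Cauchy_Schwarz_ineq2])
      (intro mult_right_mono norm_\<Delta>_frame Gs_frame norm_ge_zero)
  ultimately show "\<bar>X \<bullet> (\<Delta> ** X) - Gs \<bullet> (\<Delta> ** Gs)\<bar> \<le> q ^ 5 / 40 * norm (perp X)"
    by linarith
qed

text \<open>Measured in units of \<open>q\<close>, all terms carry the factor \<open>q ^ 6\<close>,
  which cancels. What remains is \<open>y\<^sup>2 \<le> y0\<^sup>2 + (y + y0) / 40\<close>, and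
  \<open>y0 \<le> 1/38\<close> keeps \<open>y\<close> below \<open>1/18\<close>.\<close>

lemma norm_perp_superlevel:
  assumes X: "transpose X ** X = n *\<^sub>R mat 1" and X0: "transpose X0 ** X0 = n *\<^sub>R mat 1"
    and le: "objective C X0 \<le> objective C X" and init: "norm (perp X0) \<le> q / 38"
  shows "norm (perp X) \<le> q / 18"
proof -
  define y y0 where "y = norm (perp X) / q" and "y0 = norm (perp X0) / q"
  have y: "norm (perp X) = q * y" "norm (perp X0) = q * y0"
    using q_powers(5) by (simp_all add: y_def y0_def)
  have y0: "0 \<le> y0" "y0 \<le> 1 / 38"
    using init q_powers(5) by (simp_all add: y0_def divide_simps)
  have "n * (norm (perp X))\<^sup>2 \<le> n * (norm (perp X0))\<^sup>2 + q ^ 5 / 40 * norm (perp X) + q ^ 5 / 40 * norm (perp X0)"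
    using le objective_frame(2)[OF X] objective_frame(2)[OF X0]
    unfolding objective_frame(1)[OF X] objective_frame(1)[OF X0] by linarith
  then have "q ^ 6 * y\<^sup>2 \<le> q ^ 6 * (y0\<^sup>2 + (y + y0) / 40)"
    unfolding y by (simp add: q(2)[symmetric] power_mult_distrib algebra_simps add_divide_distrib power_numeral_reduce)
  then have "y\<^sup>2 \<le> y0\<^sup>2 + (y + y0) / 40"
    using q_powers(5) by simp
  then have "y * (y - 1 / 40) \<le> y0\<^sup>2 + y0 / 40"
    by (simp add: power2_eq_square right_diff_distrib add_divide_distrib)
  moreover have "y0\<^sup>2 \<le> (1 / 38)\<^sup>2"
    using y0 by (intro power_mono) auto
  then have "y0\<^sup>2 \<le> 7 / 10000" by (simp add: power2_eq_square)
  moreover have "y0 / 40 \<le> 7 / 10000" using y0 by simp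
  ultimately have upper: "y * (y - 1 / 40) \<le> 14 / 10000"
    by linarith
  have "y \<le> 1 / 18"
  proof (rule ccontr)
    assume "\<not> y \<le> 1 / 18"
    then have "(1 / 18) * (1 / 18 - 1 / 40) \<le> y * (y - 1 / 40)"
      by (intro mult_mono) auto
    with upper show False by simp
  qed
  then show ?thesis
    unfolding y using q_powers(5) by simp
qed

text \<open>With \<open>L\<close> the difference of the block diagonal multiplier with blocks \<open>X\<^sub>i S\<^sub>i X\<^sub>i\<^sup>T\<close> and \<open>C\<close>, every
  \<open>Y \<in> O(d)\<^sup>n\<close> satisfies \<open>f Y - f X = - \<langle>Y, L Y\<rangle>\<close>.  Splitting \<open>Y = X N + R\<close> with \<open>X\<^sup>T R = 0\<close>, the term in
  \<open>X N\<close> vanishes since \<open>X\<^sup>T L X\<close> is skew, the mixed terms are controlled by the gradient, and \<open>L\<close> is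
  positive definite on \<open>R\<close>.\<close>

lemma gradient_dominance_aux:
  assumes X: "good X" and Y: "Y \<in> blocks_in O_group"
  defines "R \<equiv> Y - X ** ((1 / n) *\<^sub>R (transpose X ** Y))"
  shows "objective C Y - objective C X \<le> 2 * norm R * norm (residual X) - n / 2 * (norm R)\<^sup>2"
proof -
  have O: "X \<in> blocks_in O_group" using X by (simp add: good_def)
  note frX = good_frame[OF X]
  have frY: "transpose Y ** Y = n *\<^sub>R mat 1"
    using O_blocks_frame[OF Y] by (simp add: n_def)
  define N where "N = (1 / n) *\<^sub>R (transpose X ** Y)"
  note fr = frame_overlap[OF n_pos frX frY, folded N_def, folded d_def]
  have R: "R = Y - X ** N" by (simp add: R_def N_def)
  have XR: "transpose X ** R = 0" using fr(1) by (simp add: R)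
  have contr: "norm (A ** N) \<le> norm A" for A :: "('n, 'd) bcol"
    using norm_matmul_contraction[OF n_pos fr(4)] .
  define \<Lambda> where "\<Lambda> U = stack (\<lambda>i. block X i ** (sym_part X i ** (transpose (block X i) ** block U i)))"
    for U :: "('n, 'd) bcol"
  define L where "L U = \<Lambda> U - C ** U" for U
  have inner_\<Lambda>: "U \<bullet> \<Lambda> V = (\<Sum>i\<in>UNIV. (transpose (block X i) ** block U i) \<bullet>
      (sym_part X i ** (transpose (block X i) ** block V i)))" for U V
    unfolding inner_block[of U] \<Lambda>_def block_stack
    by (intro sum.cong refl) (simp add: inner_matmul_left[of "transpose _", simplified])
  have \<Lambda>_sym: "U \<bullet> \<Lambda> V = \<Lambda> U \<bullet> V" for U V
    unfolding inner_commute[of "\<Lambda> U"] inner_\<Lambda>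
  proof (intro sum.cong refl)
    fix i
    let ?U = "transpose (block X i) ** block U i" and ?V = "transpose (block X i) ** block V i"
    show "?U \<bullet> (sym_part X i ** ?V) = ?V \<bullet> (sym_part X i ** ?U)"
      using inner_matmul_left[of "sym_part X i" ?V ?U]
      by (simp only: sym_part_sym inner_commute[of ?U])
  qed
  \<comment> \<open>On orthogonal blocks the multiplier form is constant, so comparing objectives
    amounts to comparing the forms of \<open>L\<close>.\<close>
  have \<Lambda>_O: "U \<bullet> \<Lambda> U = (\<Sum>i\<in>UNIV. mat 1 \<bullet> sym_part X i)" if U: "U \<in> blocks_in O_group" for U
    unfolding inner_\<Lambda>
  proof (intro sum.cong refl)
    fix i
    let ?Q = "transpose (block X i) ** block U i"
    have "?Q ** transpose ?Q = mat 1"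
      by (metis (no_types, lifting) O_blockD(1)[OF O] O_blockD(2)[OF U] matrix_mul_assoc
          matrix_mul_rid matrix_transpose_mul transpose_transpose)
    with inner_matmul_right[of "sym_part X i" ?Q ?Q]
    show "?Q \<bullet> (sym_part X i ** ?Q) = mat 1 \<bullet> sym_part X i"
      by (simp only: inner_commute[of ?Q] inner_commute[of "mat 1"])
  qed
  have L_sym: "U \<bullet> L V = L U \<bullet> V" for U V
    by (simp add: L_def inner_diff_left inner_diff_right \<Lambda>_sym inner_C_commute)
  have L_add: "L (U + V) = L U + L V" for U V
  proof -
    have "\<Lambda> (U + V) = \<Lambda> U + \<Lambda> V"
      by (rule block_eqI) (simp add: \<Lambda>_def block_linear matmul.add_right)
    then show ?thesis by (simp add: L_def matmul.add_right)
  qed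
  have L_mult: "L (U ** A) = L U ** A" for U A
  proof -
    have "\<Lambda> (U ** A) = \<Lambda> U ** A"
      by (rule block_eqI) (simp add: \<Lambda>_def block_matmul matrix_mul_assoc)
    then show ?thesis by (simp add: L_def matmul.diff_left matrix_mul_assoc)
  qed
  have LX: "L X = - residual X"
  proof (rule block_eqI)
    fix i
    have "block (C ** X) i = block X i ** local_form X i"
      by (simp add: local_form_def matrix_mul_assoc O_blockD(2)[OF O])
    then show "block (L X) i = block (- residual X) i"
      by (simp add: L_def \<Lambda>_def residual_def block_linear O_blockD(1)[OF O] sym_plus_skew[symmetric]
          matmul.add_right)
  qed
  have skew: "transpose X ** residual X = (\<Sum>i\<in>UNIV. skew_part X i)"
    by (simp add: block_transpose_matmul residual_def matrix_mul_assoc O_blockD(1)[OF O])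
  have skew': "transpose (\<Sum>i\<in>UNIV. skew_part X i) = - (\<Sum>i\<in>UNIV. skew_part X i)"
    by (simp add: transpose_linear skew_part_skew sum_negf)
  have XN: "(X ** A) \<bullet> L (X ** A) = 0" for A :: "real ^ 'd ^ 'd"
    using inner_skew_quadratic[OF skew', of A]
    by (simp add: L_mult LX inner_matmul_left matmul.minus_left matmul.minus_right matrix_mul_assoc skew)
  have "objective C Y - objective C X = X \<bullet> L X - Y \<bullet> L Y"
    by (simp add: objective_inner L_def inner_diff_right \<Lambda>_O Y O)
  also have "X \<bullet> L X = 0" using XN[of "mat 1"] by simp
  also have "Y \<bullet> L Y = 2 * (R \<bullet> L (X ** N)) + R \<bullet> L R"
  proof -
    have "Y = X ** N + R" by (simp add: R)
    then show ?thesis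
      using L_sym[of "X ** N" R] XN[of N]
      by (simp add: L_add inner_add_left inner_add_right inner_commute)
  qed
  finally have eq: "objective C Y - objective C X = - 2 * (R \<bullet> L (X ** N)) - R \<bullet> L R" by simp
  have mixed: "\<bar>R \<bullet> L (X ** N)\<bar> \<le> norm R * norm (residual X)"
    unfolding L_mult LX
    by (rule order_trans[OF Cauchy_Schwarz_ineq2])
      (use contr[of "- residual X"] in \<open>auto intro!: mult_left_mono\<close>)
  have "n * (896 / 1000) * (norm R)\<^sup>2 \<le> R \<bullet> \<Lambda> R"
    unfolding inner_\<Lambda> sq_norm_block[of R] sum_distrib_left
  proof (rule sum_mono)
    fix i
    define T where "T = transpose (block X i) ** block R i"
    define Z where "Z = (1 / 2) *\<^sub>R ((local_form X i - n *\<^sub>R mat 1) + transpose (local_form X i - n *\<^sub>R mat 1))"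
    have T: "norm T = norm (block R i)" by (simp add: T_def O_blockD(4)[OF O])
    have "norm Z \<le> n * (norm (block (perp X) i) + 1 / 250)"
      unfolding Z_def by (rule order_trans[OF norm_skew_sym_le(2) local_form_near[OF X]])
    also have "norm (block (perp X) i) \<le> 1 / 10" using X by (simp add: good_def)
    also have "n * (1 / 10 + 1 / 250) = n * (104 / 1000)" by simp
    finally have Z: "norm Z \<le> n * (104 / 1000)" using n_pos by simp
    have "sym_part X i = n *\<^sub>R mat 1 + Z"
      by (simp add: sym_part_def Z_def transpose_linear vec_eq_iff field_simps)
    then have "T \<bullet> (sym_part X i ** T) = n * (norm T)\<^sup>2 + T \<bullet> (Z ** T)"
      by (simp add: matmul.add_left matmul.scaleR_left inner_add_right power2_norm_eq_inner)
    moreover have "\<bar>T \<bullet> (Z ** T)\<bar> \<le> n * (104 / 1000) * (norm T)\<^sup>2"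
    proof -
      have "\<bar>T \<bullet> (Z ** T)\<bar> \<le> norm T * (norm Z * norm T)"
        by (rule order_trans[OF Cauchy_Schwarz_ineq2]) (intro mult_left_mono norm_matmul_le norm_ge_zero)
      also have "\<dots> = norm Z * (norm T)\<^sup>2" by (simp add: power2_eq_square)
      also have "\<dots> \<le> n * (104 / 1000) * (norm T)\<^sup>2" by (intro mult_right_mono Z) simp
      finally show ?thesis .
    qed
    ultimately have "n * (896 / 1000) * (norm T)\<^sup>2 \<le> T \<bullet> (sym_part X i ** T)"
      by (simp add: algebra_simps)
    then show "n * (896 / 1000) * (norm (block R i))\<^sup>2 \<le> (transpose (block X i) ** block R i) \<bullet>
        (sym_part X i ** (transpose (block X i) ** block R i))"
      by (simp add: T_def[symmetric] T)
  qed
  moreover have "R \<bullet> (C ** R) \<le> n * (17 / 1000) * (norm R)\<^sup>2"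
  proof -
    \<comment> \<open>Since \<open>R\<close> is orthogonal to the columns of \<open>X\<close>, the
      signal meets \<open>R\<close> only through the small residual \<open>coperp X\<close>.\<close>
    have "transpose Gs ** R = transpose (coperp X) ** R"
      by (simp add: coperp_def transpose_linear matrix_transpose_mul matmul.diff_left
          matrix_mul_assoc[symmetric] XR matmul.zero_right)
    then have "norm (transpose Gs ** R) \<le> norm (perp X) * norm R"
      using norm_matmul_le[of "transpose (coperp X)" R] frame_overlap_facts(6)[OF frX] by simp
    also have "\<dots> \<le> q / 18 * norm R"
      using X by (intro mult_right_mono) (auto simp: good_def)
    finally have "(norm (transpose Gs ** R))\<^sup>2 \<le> (q / 18 * norm R)\<^sup>2"
      by (rule power_mono) simp
    also have "\<dots> = q\<^sup>2 * ((norm R)\<^sup>2 / 324)"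
      by (simp add: power_mult_distrib power_divide)
    also have "\<dots> \<le> n * ((norm R)\<^sup>2 / 324)"
      using q_powers(2) by (intro mult_right_mono) auto
    finally have "R \<bullet> (C ** R) \<le> n * ((norm R)\<^sup>2 / 324) + n / 80 * (norm R)\<^sup>2"
      using abs_inner_\<Delta>_le[of R] by (simp add: inner_C_matmul[of R R] power2_norm_eq_inner)
    also have "\<dots> = (1 / 324 + 1 / 80) * (n * (norm R)\<^sup>2)" by (simp add: algebra_simps)
    also have "\<dots> \<le> 17 / 1000 * (n * (norm R)\<^sup>2)"
      using n_pos by (intro mult_right_mono) auto
    finally show ?thesis by simp
  qed
  moreover have "R \<bullet> L R = R \<bullet> \<Lambda> R - R \<bullet> (C ** R)"
    by (simp add: L_def inner_diff_right)
  ultimately have "n * (896 / 1000) * (norm R)\<^sup>2 - n * (17 / 1000) * (norm R)\<^sup>2 \<le> R \<bullet> L R"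
    by linarith
  moreover have "0 \<le> n * (norm R)\<^sup>2" using n_pos by simp
  ultimately have "n / 2 * (norm R)\<^sup>2 \<le> R \<bullet> L R" by simp
  with eq mixed show ?thesis by (simp add: abs_le_iff)
qed

text \<open>A Polyak-Lojasiewicz inequality: the preceding bound is a concave quadratic in
  \<open>r\<close>, largest at \<open>r = 2 w / n\<close>.\<close>

lemma gradient_dominance:
  assumes "good X" and "Y \<in> blocks_in O_group"
  shows "objective C Y - objective C X \<le> 2 / n * (norm (residual X))\<^sup>2"
proof -
  define r where "r = norm (Y - X ** ((1 / n) *\<^sub>R (transpose X ** Y)))"
  define w where "w = norm (residual X)"
  have "0 \<le> (n * r - 2 * w)\<^sup>2 / (2 * n)" using n_pos by simp
  also have "\<dots> = n / 2 * r\<^sup>2 - 2 * r * w + 2 / n * w\<^sup>2"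
    using n_pos by (simp add: power2_eq_square field_simps)
  finally show ?thesis
    using gradient_dominance_aux[OF assms] by (simp add: r_def w_def)
qed

text \<open>The same quadratic solved for \<open>r\<close>: a nonnegative gap forces
  \<open>n / 2 * r\<^sup>2 \<le> 2 r w\<close>. This error bound later identifies the limit.\<close>

lemma distance_to_maximizer:
  assumes "good X" and "Y \<in> blocks_in O_group" and "objective C X \<le> objective C Y"
  shows "norm (Y - X ** ((1 / n) *\<^sub>R (transpose X ** Y))) \<le> 4 / n * norm (residual X)"
proof -
  define r where "r = norm (Y - X ** ((1 / n) *\<^sub>R (transpose X ** Y)))"
  define w where "w = norm (residual X)"
  have "0 \<le> r * (2 * w - n / 2 * r)"
    using gradient_dominance_aux[OF assms(1,2)] assms(3)
    by (simp add: r_def w_def power2_eq_square algebra_simps)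
  then have "r = 0 \<or> n / 2 * r \<le> 2 * w"
    by (auto simp: zero_le_mult_iff r_def)
  then have "r \<le> 4 / n * w"
    using n_pos by (auto simp: field_simps w_def)
  then show ?thesis by (simp add: r_def w_def)
qed

end

section \<open>From geometric decrease to convergence\<close>

lemma geometric_steps_converge:
  fixes x :: "nat \<Rightarrow> 'a::banach"
  assumes r: "0 \<le> r" "r < 1" and step: "\<And>k. norm (x (Suc k) - x k) \<le> c * r ^ k"
  obtains L where "x \<longlonglongrightarrow> L" "\<And>k. norm (x k - L) \<le> c / (1 - r) * r ^ k"
proof -
  have geo: "summable (\<lambda>j. c * r ^ (j + k))" for k
    using r by (intro summable_mult summable_ignore_initial_segment summable_geometric) auto
  have sums: "summable (\<lambda>j. x (Suc (j + k)) - x (j + k))" for k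
    by (rule summable_comparison_test'[OF geo[of k]]) (rule step)
  obtain L where "(\<lambda>k. x k - x 0) \<longlonglongrightarrow> L"
    using sums[of 0] sum_lessThan_telescope[of x] by (auto simp: summable_def sums_def)
  then have lim: "x \<longlonglongrightarrow> L + x 0"
    using tendsto_add[OF _ tendsto_const[of "x 0"]] by fastforce
  have "norm (x k - (L + x 0)) \<le> c / (1 - r) * r ^ k" for k
  proof -
    have "(\<lambda>j. x (j + k)) \<longlonglongrightarrow> L + x 0"
      using lim by (rule LIMSEQ_ignore_initial_segment)
    from telescope_sums[OF this] have "(\<Sum>j. x (Suc (j + k)) - x (j + k)) = L + x 0 - x k"
      by (simp add: sums_iff)
    moreover have "norm (\<Sum>j. x (Suc (j + k)) - x (j + k)) \<le> (\<Sum>j. c * r ^ (j + k))"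
      by (rule norm_suminf_le[OF step geo])
    moreover have "(\<Sum>j. c * r ^ (j + k)) = c / (1 - r) * r ^ k"
      using r suminf_mult[of "\<lambda>j. r ^ j" "c * r ^ k"]
      by (simp add: power_add suminf_geometric summable_geometric mult.commute mult.left_commute)
    ultimately show ?thesis by (simp add: norm_minus_commute)
  qed
  with lim that show ?thesis by blast
qed

theorem corollary6p7:
  fixes \<G> :: "(real ^ 'd::finite ^ 'd) set"
    and Gstar Ghat \<Phi> :: "('n::finite, 'd) bcol"
    and \<Delta> C :: "('n, 'd) bmat"
    and G :: "nat \<Rightarrow> ('n, 'd) bcol"
    and t :: "nat \<Rightarrow> real"
    and tmin :: real
  defines "n \<equiv> real CARD('n)" and "d \<equiv> real CARD('d)"
  assumes group: "\<G> = O_group \<or> \<G> = SO_group"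
    and Gstar: "Gstar \<in> blocks_in \<G>"
    and \<Delta>_sym: "transpose \<Delta> = \<Delta>"
    and C: "C = Gstar ** transpose Gstar + \<Delta>"
    and Ghat: "is_arg_max (objective C) (\<lambda>X. X \<in> blocks_in O_group) Ghat"
    and \<Delta>_op: "op_norm \<Delta> \<le> n powr (3/4) / (80 * sqrt d)"
    and \<Delta>_sup: "block_sup_norm (\<Delta> ** Gstar) \<le> n / (400 * d)"
    and \<Phi>_top: "top_eigenvectors C \<Phi>"
    and \<Phi>_norm: "transpose \<Phi> ** \<Phi> = n *\<^sub>R mat 1"
    \<comment> \<open>Replacing \<Phi> by \<Phi>Q with Q orthogonal and det Q = -1 can give another matrix of top
      eigenvectors.  For SO(d) the orientation has to be the right one: without it all blocks of \<Phi> may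
      be orthogonal with determinant -1, their nearest rotations are then highly ambiguous, and the
      conclusion fails.\<close>
    and \<Phi>_oriented: "\<G> = SO_group \<Longrightarrow> \<exists>i. 0 < det (block \<Phi> i)"
    and init: "is_block_projection \<G> \<Phi> (G 0)"
    and iter: "\<And>k. G (Suc k) = riemannian_exp (G k) (t k *\<^sub>R riemannian_grad C (G k))"
    and tmin: "0 < tmin"
    and step: "\<And>k. tmin \<le> t k \<and> t k \<le> 1 / (4 * n * d)"
  shows "converges_Q_linearly (\<lambda>k. quotient_objective C (orbit (G k)))
           (quotient_objective C (orbit Ghat)) \<and>
    (\<exists>Glim \<in> orbit Ghat. converges_R_linearly G Glim \<and>
      (\<exists>a \<rho>. 0 < a \<and> 0 < \<rho> \<and> \<rho> < 1 \<and>
        (\<forall>k. quotient_objective C (orbit Ghat) - quotient_objective C (orbit (G k))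
               \<le> (quotient_objective C (orbit Ghat) - quotient_objective C (orbit (G 0))) * \<rho> ^ k \<and>
             norm (G k - Glim)
               \<le> a * sqrt (quotient_objective C (orbit Ghat) - quotient_objective C (orbit (G 0)))
                   * \<rho> powr (real k / 2))))"
proof -
  define q where "q = n powr (1 / 4)"
  have n: "1 \<le> n" and d: "1 \<le> d"
    by (simp_all add: n_def d_def)
  have q: "1 \<le> q" "q ^ 4 = n" "q ^ 3 = n powr (3 / 4)"
    using n by (simp_all add: q_def ge_one_powr_ge_zero powr_power)
  interpret synchronization Gstar \<Delta> C n d q
  proof
    show "Gstar \<in> blocks_in O_group"
      using group Gstar by (auto simp: blocks_in_def SO_group_def O_group_def rotation_matrix_def)
    show "op_norm \<Delta> * (80 * sqrt d) \<le> q ^ 3"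
      using \<Delta>_op d by (simp add: q(3) pos_le_divide_eq)
    show "norm (block (\<Delta> ** Gstar) i) \<le> n / 400" for i
    proof -
      have "n / (400 * d) \<le> n / 400"
        using n d by (intro divide_left_mono) auto
      then show ?thesis
        using norm_block_le_sup[of "\<Delta> ** Gstar" i] \<Delta>_sup by linarith
    qed
  qed (use \<Delta>_sym C q in \<open>auto simp: n_def d_def\<close>)
  have GhatO: "Ghat \<in> blocks_in O_group" and max: "\<And>X. X \<in> blocks_in O_group \<Longrightarrow> objective C X \<le> objective C Ghat"
    using Ghat by (auto simp: is_arg_max_def not_less)
  have t: "0 \<le> t k" "t k * n \<le> 1 / 4" "0 < t k" "t k \<le> 1 / 4" for k
  proof -
    have "t k \<le> 1 / (4 * n * d)" using step by blast
    also have "\<dots> \<le> 1 / (4 * n)"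
      using n d by (intro divide_left_mono) auto
    finally show tn: "t k * n \<le> 1 / 4" using n by (simp add: field_simps)
    show pos: "0 < t k" using tmin step[of k] by linarith
    then have "t k * 1 \<le> t k * n" using n by (intro mult_left_mono) auto
    with tn pos show "0 \<le> t k" "t k \<le> 1 / 4" by linarith+
  qed
  note init_facts = initialization[OF group Gstar \<Phi>_top \<Phi>_norm \<Phi>_oriented init]
  have frame: "transpose X ** X = n *\<^sub>R mat 1" if "X \<in> blocks_in O_group" for X :: "('n, 'd) bcol"
    using O_blocks_frame[OF that] by (simp add: n_def)
  have good0: "good (G 0)"
    using init_facts q_powers(5) by (simp add: good_def)
  \<comment> \<open>Ascent over the initial point is carried along because the Frobenius bound is
    rederived from \<open>q / 38\<close> at the start each time; deriving it from the previous
    iterate would let it deteriorate.\<close>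
  have "good (G k) \<and> objective C (G 0) \<le> objective C (G k)" for k
  proof (induction k)
    case (Suc k)
    then have good: "good (G k)" and le: "objective C (G 0) \<le> objective C (G k)" by auto
    then have GO: "G k \<in> blocks_in O_group" by (simp add: good_def)
    have G: "G (Suc k) = step (G k) (t k)"
      unfolding iter by (rule riemannian_step[OF GO])
    have "objective C (G k) \<le> objective C (G (Suc k))"
      using sufficient_ascent[OF good t(1,2)[of k]] mult_nonneg_nonneg[OF t(1)[of k], of "(norm (residual (G k)))\<^sup>2"]
      by (simp add: G)
    with le have le': "objective C (G 0) \<le> objective C (G (Suc k))" by linarith
    have O: "G (Suc k) \<in> blocks_in O_group"
      unfolding G by (rule step_in_O[OF GO])
    have "norm (perp (G (Suc k))) \<le> q / 18"
      by (rule norm_perp_superlevel[OF frame[OF O] frame[OF init_facts(1)] le' init_facts(2)])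
    with O le' show ?case
      using block_perp_step[OF good t(1,2)] by (simp add: good_def G)
  qed (use good0 in simp)
  then have good: "good (G k)" for k by blast
  then have GO: "G k \<in> blocks_in O_group" for k by (simp add: good_def)
  have G: "G (Suc k) = step (G k) (t k)" for k
    unfolding iter by (rule riemannian_step[OF GO])
  define gap where "gap k = objective C Ghat - objective C (G k)" for k
  define w where "w k = norm (residual (G k))" for k
  \<comment> \<open>Ascent by \<open>2 t w\<^sup>2\<close> together with
    \<open>n * gap \<le> 2 w\<^sup>2\<close> removes at least the fraction \<open>t n\<close> of the
    gap.\<close>
  define \<rho> where "\<rho> = 1 - tmin * n"
  have gap0: "0 \<le> gap k" for k using max[OF GO] by (simp add: gap_def)
  have "tmin * n \<le> t 0 * n" using step n by (intro mult_right_mono) auto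
  then have \<rho>: "0 < \<rho>" "\<rho> < 1"
    using t(2)[of 0] tmin n mult_pos_pos[of tmin n] unfolding \<rho>_def by linarith+
  have ascent: "gap (Suc k) + 2 * t k * (w k)\<^sup>2 \<le> gap k" for k
    using sufficient_ascent[OF good[of k] t(1,2)[of k]] by (simp add: gap_def w_def G)
  have dom: "n * gap k \<le> 2 * (w k)\<^sup>2" for k
    using gradient_dominance[OF good GhatO, of k] n by (simp add: gap_def w_def field_simps)
  have contract: "gap (Suc k) \<le> \<rho> * gap k" for k
  proof -
    have "(tmin * n) * gap k \<le> (t k * n) * gap k"
      using step n gap0 by (intro mult_right_mono) auto
    also have "\<dots> \<le> t k * (2 * (w k)\<^sup>2)"
      using mult_left_mono[OF dom[of k] t(1)[of k]] by (simp add: mult.assoc)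
    finally show ?thesis
      using ascent[of k] by (simp add: \<rho>_def left_diff_distrib mult.assoc)
  qed
  have gap_geo: "gap k \<le> gap 0 * \<rho> ^ k" for k
  proof (induction k)
    case (Suc k)
    have "\<rho> * gap k \<le> \<rho> * (gap 0 * \<rho> ^ k)" using Suc \<rho> by (intro mult_left_mono) auto
    with contract[of k] show ?case by (simp add: ac_simps)
  qed simp
  define r where "r = sqrt \<rho>"
  have r: "0 < r" "r < 1" "r ^ k = \<rho> powr (real k / 2)" "(r ^ k)\<^sup>2 = \<rho> ^ k" for k
  proof -
    show "0 < r" "r < 1" using \<rho> by (auto simp: r_def)
    have "r ^ k = (\<rho> powr (1 / 2)) powr real k"
      using \<rho> by (simp add: r_def powr_half_sqrt powr_realpow)
    then show "r ^ k = \<rho> powr (real k / 2)" by (simp add: powr_powr)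
    show "(r ^ k)\<^sup>2 = \<rho> ^ k" using \<rho> by (simp add: r_def power2_eq_square power_mult_distrib[symmetric])
  qed
  have w_le: "2 * t k * (w k)\<^sup>2 \<le> gap k" for k
    using ascent[of k] gap0[of "Suc k"] by linarith
  \<comment> \<open>The squared step is at most \<open>5 t\<^sup>2 w\<^sup>2\<close>, that is
    \<open>5/2 * t\<close> times \<open>2 t w\<^sup>2\<close>; ascent bounds the latter by the gap,
    and \<open>t \<le> 1/4\<close> absorbs the factor.\<close>
  have steps: "norm (G (Suc k) - G k) \<le> sqrt (gap 0) * r ^ k" for k
  proof (rule power2_le_imp_le)
    have "(norm (G (Suc k) - G k))\<^sup>2 \<le> 5 * (t k)\<^sup>2 * (w k)\<^sup>2"
      using norm_step_diff[OF good[of k] t(1,2)[of k]] by (simp add: G w_def)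
    also have "\<dots> = 5 / 2 * t k * (2 * t k * (w k)\<^sup>2)"
      by (simp add: power2_eq_square)
    also have "\<dots> \<le> 1 * gap k"
      using t[of k] w_le[of k] gap0[of k] by (intro mult_mono) auto
    also have "\<dots> \<le> gap 0 * \<rho> ^ k" using gap_geo by simp
    finally show "(norm (G (Suc k) - G k))\<^sup>2 \<le> (sqrt (gap 0) * r ^ k)\<^sup>2"
      using gap0[of 0] by (simp add: power_mult_distrib r(4))
  qed (use r(1) gap0[of 0] in auto)
  obtain Glim where lim: "G \<longlonglongrightarrow> Glim"
    and rate: "\<And>k. norm (G k - Glim) \<le> sqrt (gap 0) / (1 - r) * r ^ k"
    using geometric_steps_converge[of r G "sqrt (gap 0)"] steps r(1,2) by (metis less_imp_le)
  have "Glim \<in> orbit Ghat"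
  proof -
    have "(\<lambda>k. (w k)\<^sup>2) \<longlonglongrightarrow> 0"
    proof (rule tendsto_sandwich[where f = "\<lambda>_. 0" and h = "\<lambda>k. gap 0 / (2 * tmin) * \<rho> ^ k"])
      have "2 * tmin * (w k)\<^sup>2 \<le> gap 0 * \<rho> ^ k" for k
      proof -
        have "2 * tmin * (w k)\<^sup>2 \<le> 2 * t k * (w k)\<^sup>2"
          using step[of k] by (intro mult_right_mono) auto
        with w_le[of k] gap_geo[of k] show ?thesis by linarith
      qed
      then show "\<forall>\<^sub>F k in sequentially. (w k)\<^sup>2 \<le> gap 0 / (2 * tmin) * \<rho> ^ k"
        using tmin by (intro always_eventually allI) (simp add: field_simps)
      show "(\<lambda>k. gap 0 / (2 * tmin) * \<rho> ^ k) \<longlonglongrightarrow> 0"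
        using \<rho> by (intro tendsto_mult_right_zero LIMSEQ_power_zero) auto
    qed auto
    then have "(\<lambda>k. sqrt ((w k)\<^sup>2)) \<longlonglongrightarrow> sqrt 0" by (intro tendsto_real_sqrt)
    then have w0: "w \<longlonglongrightarrow> 0" by (simp add: w_def[abs_def])
    \<comment> \<open>In the limit the error bound reads \<open>Ghat = Glim N\<close>; comparing
      Gram matrices shows that \<open>N\<close> is orthogonal.\<close>
    define N where "N = (1 / n) *\<^sub>R (transpose Glim ** Ghat)"
    have "(\<lambda>k. Ghat - G k ** ((1 / n) *\<^sub>R (transpose (G k) ** Ghat))) \<longlonglongrightarrow> 0"
    proof (rule Lim_null_comparison)
      show "\<forall>\<^sub>F k in sequentially. norm (Ghat - G k ** ((1 / n) *\<^sub>R (transpose (G k) ** Ghat))) \<le> 4 / n * w k"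
        using distance_to_maximizer[OF good GhatO max[OF GO]] by (simp add: w_def)
      show "(\<lambda>k. 4 / n * w k) \<longlonglongrightarrow> 0" by (rule tendsto_mult_right_zero[OF w0])
    qed
    moreover have "(\<lambda>k. Ghat - G k ** ((1 / n) *\<^sub>R (transpose (G k) ** Ghat))) \<longlonglongrightarrow> Ghat - Glim ** N"
      unfolding N_def
      by (intro tendsto_intros matmul.tendsto lim bounded_linear.tendsto[OF bounded_linear_transpose])
    ultimately have Ghat_eq: "Ghat = Glim ** N"
      using LIMSEQ_unique by fastforce
    have "(\<lambda>k. transpose (G k) ** G k) \<longlonglongrightarrow> transpose Glim ** Glim"
      by (intro matmul.tendsto lim bounded_linear.tendsto[OF bounded_linear_transpose])
    then have Glim: "transpose Glim ** Glim = n *\<^sub>R mat 1"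
      by (simp add: frame[OF GO] LIMSEQ_const_iff)
    have "n *\<^sub>R mat 1 = transpose N ** (transpose Glim ** Glim) ** N"
      using frame[OF GhatO] by (simp add: Ghat_eq matrix_transpose_mul matrix_mul_assoc)
    then have "transpose N ** N = mat 1"
      using n by (simp add: Glim matmul.scaleR_left matmul.scaleR_right)
    then have N: "orthogonal_matrix N" by (simp add: orthogonal_matrix)
    then have "Glim = Ghat ** transpose N"
      by (simp add: Ghat_eq matrix_mul_assoc[symmetric] orthogonal_matrix_def)
    with N show ?thesis
      by (auto simp: orbit_def O_group_def)
  qed
  have "converges_Q_linearly (\<lambda>k. quotient_objective C (orbit (G k))) (quotient_objective C (orbit Ghat))"
    unfolding converges_Q_linearly_def quotient_objective_orbit
  proof (intro exI conjI allI)
    show "dist (objective C (G (Suc k))) (objective C Ghat) \<le> \<rho> * dist (objective C (G k)) (objective C Ghat)" for k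
      using contract[of k] gap0[of k] gap0[of "Suc k"] by (simp add: gap_def dist_real_def)
  qed (fact \<rho>)+
  moreover have "converges_R_linearly G Glim"
    unfolding converges_R_linearly_def
  proof (intro exI conjI allI)
    \<comment> \<open>The added 1 keeps the constant positive when the start is already
      optimal.\<close>
    have a: "0 \<le> sqrt (gap 0) / (1 - r)" using gap0 r by simp
    then show "0 < sqrt (gap 0) / (1 - r) + 1" by linarith
    show "dist (G k) Glim \<le> (sqrt (gap 0) / (1 - r) + 1) * r ^ k" for k
      using rate[of k] r(1) by (simp add: dist_norm distrib_right add_increasing2)
  qed (fact r)+
  moreover have "\<exists>a \<rho>. 0 < a \<and> 0 < \<rho> \<and> \<rho> < 1 \<and>
      (\<forall>k. gap k \<le> gap 0 * \<rho> ^ k \<and> norm (G k - Glim) \<le> a * sqrt (gap 0) * \<rho> powr (real k / 2))"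
  proof (intro exI conjI allI)
    show "0 < 1 / (1 - r)" using r by simp
    show "norm (G k - Glim) \<le> 1 / (1 - r) * sqrt (gap 0) * \<rho> powr (real k / 2)" for k
      using rate[of k] by (simp add: r(3))
  qed (fact \<rho> gap_geo)+
  ultimately show ?thesis
    using \<open>Glim \<in> orbit Ghat\<close> unfolding quotient_objective_orbit gap_def by blast
qed

end
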